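(* Let $\{\xi_{\mathbf i}:\mathbf i\in\mathbb Z^q\}$ be a strictly stationary, $\varphi$-mixing real-valued random field with $\mathbb E(\xi_{\mathbf 0})=0$, $\mathbb E(\xi_{\mathbf 0}^4)<\infty$, and mixing coefficients satisfying $\sum_{r=1}^\infty r^{q-1}\varphi^{1/2}(r)<\infty$. Let the weights satisfy $w_{\mathbf m}(\mathbf j)\to1$ as $\mathbf m\to\infty$ for all $\mathbf j\in\mathbb Z^q$ and $|w_{\mathbf m}(\mathbf j)|\le C_w<\infty$ with $C_w$ independent of $\mathbf j,\mathbf m$. Let $\mathbf m=\mathbf m_{\mathbf n}\in\mathbb N^q$ satisfy $\mathbf m\to\infty$ as $\mathbf n\to\infty$ and $(m^\star)^3/n_\star=o(1)$, where $m^\star=\max_im_i$, $n_\star=\min_in_i$. Let $g:\mathbb R\times[0,\infty)\to[0,1]$ be a (bounded) function and $c_{\mathbf n}(\mathbf j)$ a sequence of thresholds such that, for every $\mathbf j\in\mathbb Z^q$, $\mathbb E\big(g(\widehat\gamma_{\mathbf n}(\mathbf j),c_{\mathbf n}(\mathbf j))\big)\to1$ as $\mathbf n\to\infty$. Then the thresholding estimator $$\widehat\sigma_{\mathbf n,th}^2=\sum_{|\mathbf j|\le\mathbf m}w_{\mathbf m}(\mathbf j)\,\widehat\gamma_{\mathbf n}(\mathbf j)\,g\big(\widehat\gamma_{\mathbf n}(\mathbf j),c_{\mathbf n}(\mathbf j)\big)$$ is weakly consistent for $\sigma^2$, i.e. $\widehat\sigma_{\mathbf n,th}^2\to\sigma^2$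 in probability as $\mathbf n\to\infty$.
   Context: Fix an integer $q\ge1$. For $\mathbf n=(n_1,\dots,n_q)\in\mathbb N^q$, $\mathbf n\to\infty$ means $\min_i n_i\to\infty$ (likewise for $\mathbf m$). $\Gamma_{\mathbf n}=\{1,\dots,n_1\}\times\dots\times\{1,\dots,n_q\}$. For $\mathbf j\in\mathbb Z^q$, $|\mathbf j|\le\mathbf m$ means $|j_i|\le m_i$ for all $i$. Mixing: for $1\le j\le q$ and $r\ge0$ let $\mathcal A^+(j;r)=\sigma(\xi_{\mathbf n}:n_j\ge r,\ n_i \text{ unrestricted for } i\ne j)$ and $\mathcal A^-(j;r)=\sigma(\xi_{\mathbf n}:n_j\le r,\ n_i\text{ unrestricted for } i\neq j)$. For $r\ge1$ let $\varphi(j;r)=\sup\{|\mathbb P(B|A)-\mathbb P(B)|:A\in\mathcal A^-(j;0),B\in\mathcal A^+(j;r),\mathbb P(A)>0\}$, $\varphi(r)=\max_{1\le j\le q}\varphi(j;r)$, and $\varphi(0)=1$. The field is $\varphi$-mixing if $\varphi(r)\to0$ as $r\to\infty$. $\widehat\gamma_{\mathbf n}(\mathbf j)=|\widetilde\Gamma_{\mathbf n}(\mathbf j)|^{-1}\sum_{\mathbf i\in\widetilde\Gamma_{\mathbf n}(\mathbf j)}\xi_{\mathbf i}\xi_{\mathbf i+\mathbf j}$, where $\widetilde\Gamma_{\mathbf n}(\mathbf j)=\{\mathbf i\in\Gamma_{\mathbf n}:\mathbf i+\mathbf j\in\Gamma_{\mathbf n}\}$. The asymptotic variance is $\sigma^2=\sum_{\mathbf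 k\in\mathbb Z^q}\mathbb E(\xi_{\mathbf 0}\xi_{\mathbf k})$. The weights $w_{\mathbf m}(\mathbf j)$ are real numbers; $g$ is measurable. *)

theory Defs
  imports "HOL-Probability.Probability" "HOL-Library.Landau_Symbols"
begin

text \<open>
  The dimension \<open>q \<ge> 1\<close> is the cardinality of a finite index type \<open>'q\<close>:
  \<open>int ^ 'q\<close> is the lattice of all lags and locations, \<open>nat ^ 'q\<close> the set of sample sizes
  and truncation points.
\<close>

definition multi_at_top :: "(nat ^ 'q::finite) filter" where
  "multi_at_top = filtercomap (\<lambda>n. MIN i. n $ i) at_top"

definition random_field ::
    "'a measure \<Rightarrow> (int ^ 'q::finite \<Rightarrow> 'a \<Rightarrow> real) \<Rightarrow> bool" where
  "random_field M \<xi> \<longleftrightarrow> prob_space M \<and> (\<forall>i. \<xi> i \<in> borel_measurable M)"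

definition strictly_stationary ::
    "'a measure \<Rightarrow> (int ^ 'q::finite \<Rightarrow> 'a \<Rightarrow> real) \<Rightarrow> bool" where
  "strictly_stationary M \<xi> \<longleftrightarrow>
     (\<forall>I h. finite I \<longrightarrow>
        distr M (\<Pi>\<^sub>M i\<in>I. borel) (\<lambda>\<omega>. \<lambda>i\<in>I. \<xi> (i + h) \<omega>) =
        distr M (\<Pi>\<^sub>M i\<in>I. borel) (\<lambda>\<omega>. \<lambda>i\<in>I. \<xi> i \<omega>))"

definition field_sigma ::
    "'a measure \<Rightarrow> (int ^ 'q::finite \<Rightarrow> 'a \<Rightarrow> real) \<Rightarrow> (int ^ 'q) set \<Rightarrow> 'a set set" where
  "field_sigma M \<xi> S =
     sigma_sets (space M) {\<xi> n -` B \<inter> space M | n B. n \<in> S \<and> B \<in> sets borel}"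

definition sigma_plus ::
    "'a measure \<Rightarrow> (int ^ 'q::finite \<Rightarrow> 'a \<Rightarrow> real) \<Rightarrow> 'q \<Rightarrow> nat \<Rightarrow> 'a set set" where
  "sigma_plus M \<xi> j r = field_sigma M \<xi> {n. n $ j \<ge> int r}"

definition sigma_minus ::
    "'a measure \<Rightarrow> (int ^ 'q::finite \<Rightarrow> 'a \<Rightarrow> real) \<Rightarrow> 'q \<Rightarrow> nat \<Rightarrow> 'a set set" where
  "sigma_minus M \<xi> j r = field_sigma M \<xi> {n. n $ j \<le> int r}"

definition phi_dir ::
    "'a measure \<Rightarrow> (int ^ 'q::finite \<Rightarrow> 'a \<Rightarrow> real) \<Rightarrow> 'q \<Rightarrow> nat \<Rightarrow> real" where
  "phi_dir M \<xi> j r =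
     Sup {\<bar>measure M (B \<inter> A) / measure M A - measure M B\<bar> | A B.
            A \<in> sigma_minus M \<xi> j 0 \<and> B \<in> sigma_plus M \<xi> j r \<and> measure M A > 0}"

definition phi_mix ::
    "'a measure \<Rightarrow> (int ^ 'q::finite \<Rightarrow> 'a \<Rightarrow> real) \<Rightarrow> nat \<Rightarrow> real" where
  "phi_mix M \<xi> r = (if r = 0 then 1 else (MAX j. phi_dir M \<xi> j r))"

definition phi_mixing ::
    "'a measure \<Rightarrow> (int ^ 'q::finite \<Rightarrow> 'a \<Rightarrow> real) \<Rightarrow> bool" where
  "phi_mixing M \<xi> \<longleftrightarrow> phi_mix M \<xi> \<longlonglongrightarrow> 0"

definition Gamma_box :: "nat ^ 'q::finite \<Rightarrow> (int ^ 'q) set" where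
  "Gamma_box n = {i. \<forall>l. 1 \<le> i $ l \<and> i $ l \<le> int (n $ l)}"

definition Gamma_lag :: "nat ^ 'q::finite \<Rightarrow> int ^ 'q \<Rightarrow> (int ^ 'q) set" where
  "Gamma_lag n j = {i \<in> Gamma_box n. i + j \<in> Gamma_box n}"

text \<open>If \<open>Gamma_lag n j\<close> is empty, the following is \<open>0 / 0 = 0\<close>.\<close>

definition gamma_hat ::
    "(int ^ 'q::finite \<Rightarrow> 'a \<Rightarrow> real) \<Rightarrow> nat ^ 'q \<Rightarrow> int ^ 'q \<Rightarrow> 'a \<Rightarrow> real" where
  "gamma_hat \<xi> n j \<omega> =
     (\<Sum>i\<in>Gamma_lag n j. \<xi> i \<omega> * \<xi> (i + j) \<omega>) / real (card (Gamma_lag n j))"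

definition asymptotic_variance ::
    "'a measure \<Rightarrow> (int ^ 'q::finite \<Rightarrow> 'a \<Rightarrow> real) \<Rightarrow> real" where
  "asymptotic_variance M \<xi> = (\<Sum>\<^sub>\<infinity>k. integral\<^sup>L M (\<lambda>\<omega>. \<xi> 0 \<omega> * \<xi> k \<omega>))"

definition lag_box :: "nat ^ 'q::finite \<Rightarrow> (int ^ 'q) set" where
  "lag_box m = {j. \<forall>i. \<bar>j $ i\<bar> \<le> int (m $ i)}"

definition sigma_hat_th ::
    "(int ^ 'q::finite \<Rightarrow> 'a \<Rightarrow> real) \<Rightarrow> (nat ^ 'q \<Rightarrow> int ^ 'q \<Rightarrow> real) \<Rightarrow>
     (real \<times> real \<Rightarrow> real) \<Rightarrow> (nat ^ 'q \<Rightarrow> int ^ 'q \<Rightarrow> real) \<Rightarrow> (nat ^ 'q \<Rightarrow> nat ^ 'q) \<Rightarrow>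
     nat ^ 'q \<Rightarrow> 'a \<Rightarrow> real" where
  "sigma_hat_th \<xi> w g c m n \<omega> =
     (\<Sum>j\<in>lag_box (m n). w (m n) j * gamma_hat \<xi> n j \<omega> * g (gamma_hat \<xi> n j \<omega>, c n j))"

definition tendsto_in_prob ::
    "'a measure \<Rightarrow> ('b \<Rightarrow> 'a \<Rightarrow> real) \<Rightarrow> real \<Rightarrow> 'b filter \<Rightarrow> bool" where
  "tendsto_in_prob M X l F \<longleftrightarrow>
     (\<forall>\<epsilon>>0. ((\<lambda>n. measure M {\<omega> \<in> space M. \<bar>X n \<omega> - l\<bar> > \<epsilon>}) \<longlongrightarrow> 0) F)"

end

theory Submission
  imports Defs
begin

text \<open>The estimator is a sum over the lag box of sample autocovariances, weighted by \<open>w\<close> and by threshold factors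
  with values in \<open>[0,1]\<close>.  Convergence holds in \<open>L\<^sup>1\<close>, hence in probability by Markov's inequality.

  First, all sample autocovariances in the lag box may be replaced by the true ones simultaneously.  The
  covariance inequality \<open>\<bar>Cov(X,Y)\<bar> \<le> 2 \<phi>\<^bsup>1/2\<^esup> \<parallel>X\<parallel>\<^sub>2 \<parallel>Y\<parallel>\<^sub>2\<close> (\<open>mixing_covariance\<close>) is applied to
  products of two sites; four moments make these products square integrable.  Summed over all displacements with the
  lattice point count \<open>sum_max_norm_shifted_le\<close>, it shows that the mean-square error at a lag \<open>j\<close> of
  max-norm at most \<open>a\<close> is \<open>O(a\<^sup>q / b\<^sup>q)\<close>, where \<open>b\<close> is the smallest side of the sampling window
  (\<open>gamma_hat_L2\<close>).  The sum of the \<open>O(a\<^sup>q)\<close> corresponding \<open>L\<^sup>1\<close> errors is therefore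
  \<open>O((a\<^sup>3/b)\<^bsup>q/2\<^esup>)\<close>, which tends to \<open>0\<close> by the rate condition (\<open>sum_gamma_hat_L1_tendsto_0\<close>).

  Second, the same covariance inequality makes the autocovariances absolutely summable
  (\<open>autocov_abs_summable\<close>).  The error made by the weights and the threshold factors at lag \<open>j\<close> is at most
  \<open>\<bar>autocov j\<bar>\<close> times a bounded number which tends to \<open>0\<close> for each fixed \<open>j\<close>, because a threshold factor
  \<open>G \<le> 1\<close> satisfies \<open>E\<bar>G - 1\<bar> = 1 - E G\<close>.  Dominated convergence (\<open>tendsto_sum_dominated\<close>) disposes of
  this error, and the lag boxes exhaust the lattice.\<close>

section \<open>Counting lattice points\<close>

lemma card_vec_box:
  fixes S :: "'q::finite \<Rightarrow> 'b set"
  assumes "\<And>l. finite (S l)"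
  shows "finite {k :: 'b ^ 'q. \<forall>l. k $ l \<in> S l}"
    and "card {k :: 'b ^ 'q. \<forall>l. k $ l \<in> S l} = (\<Prod>l\<in>UNIV. card (S l))"
proof -
  have eq: "{k :: 'b ^ 'q. \<forall>l. k $ l \<in> S l} = vec_lambda ` PiE UNIV S"
    by (force simp: image_iff PiE_def Pi_def vec_lambda_unique intro!: bexI[where x="vec_nth _"])
  have inj: "inj_on vec_lambda (PiE UNIV S)"
    by (auto simp: inj_on_def vec_eq_iff fun_eq_iff)
  have fin: "finite (PiE UNIV S)"
    using assms by (intro finite_PiE) auto
  show "finite {k :: 'b ^ 'q. \<forall>l. k $ l \<in> S l}"
    unfolding eq using fin by simp
  show "card {k :: 'b ^ 'q. \<forall>l. k $ l \<in> S l} = (\<Prod>l\<in>UNIV. card (S l))"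
    unfolding eq using card_image[OF inj] card_PiE[of UNIV S] by simp
qed

definition max_norm :: "int ^ 'q::finite \<Rightarrow> nat" where
  "max_norm k = (MAX l. nat \<bar>k $ l\<bar>)"

lemma max_norm_le_iff: "max_norm k \<le> r \<longleftrightarrow> (\<forall>l. \<bar>k $ l\<bar> \<le> int r)"
  unfolding max_norm_def by (auto simp: nat_le_iff)

lemma max_norm_attained: "\<exists>l. int (max_norm k) = \<bar>k $ l\<bar>"
proof -
  have "max_norm k \<in> range (\<lambda>l. nat \<bar>k $ l\<bar>)"
    unfolding max_norm_def by (intro Max_in) auto
  then show ?thesis by auto
qed

lemma max_norm_ge: "\<bar>k $ l\<bar> \<le> int (max_norm k)"
  using max_norm_le_iff[of k "max_norm k"] by simp

lemma max_norm_minus [simp]: "max_norm (- k) = max_norm k"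
  by (simp add: max_norm_def)

lemma max_norm_ball:
  shows "finite {k :: int ^ 'q::finite. max_norm k \<le> r}"
    and "card {k :: int ^ 'q. max_norm k \<le> r} = (2 * r + 1) ^ CARD('q)"
proof -
  have eq: "{k :: int ^ 'q. max_norm k \<le> r} = {k. \<forall>l. k $ l \<in> {- int r..int r}}"
    by (auto simp: max_norm_le_iff abs_le_iff minus_le_iff)
  have "card {- int r..int r} = 2 * r + 1" by simp
  then show "card {k :: int ^ 'q. max_norm k \<le> r} = (2 * r + 1) ^ CARD('q)"
    unfolding eq by (subst card_vec_box) auto
  show "finite {k :: int ^ 'q. max_norm k \<le> r}"
    unfolding eq by (rule card_vec_box) auto
qed

lemma power_Suc_add_two_le:
  fixes x :: nat
  shows "(x + 2) ^ Suc p \<le> x ^ Suc p + 2 * Suc p * (x + 2) ^ p"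
proof (induction p)
  case (Suc p)
  have "(x + 2) ^ Suc (Suc p) \<le> (x + 2) * (x ^ Suc p + 2 * Suc p * (x + 2) ^ p)"
    using Suc.IH by (simp only: power_Suc[of _ "Suc p"]) (rule mult_le_mono2)
  also have "\<dots> = x ^ Suc (Suc p) + 2 * x ^ Suc p + 2 * Suc p * (x + 2) ^ Suc p"
    by (simp add: algebra_simps)
  also have "2 * x ^ Suc p \<le> 2 * (x + 2) ^ Suc p"
    by (intro mult_le_mono2 power_mono) auto
  finally show ?case by (simp add: algebra_simps)
qed simp

text \<open>The volume of the sphere is the discrete derivative of the volume \<open>(2r + 1)\<^sup>q\<close> of the ball.\<close>

lemma card_max_norm_sphere:
  "card {k :: int ^ 'q::finite. max_norm k = Suc r}
     \<le> 2 * CARD('q) * (2 * Suc r + 1) ^ (CARD('q) - 1)"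
proof -
  obtain p where p: "CARD('q) = Suc p"
    by (metis not0_implies_Suc zero_less_card_finite less_numeral_extra(3))
  have eq: "{k :: int ^ 'q. max_norm k = Suc r} = {k. max_norm k \<le> Suc r} - {k. max_norm k \<le> r}"
    by auto
  have "card {k :: int ^ 'q. max_norm k = Suc r} =
      (2 * Suc r + 1) ^ CARD('q) - (2 * r + 1) ^ CARD('q)"
    unfolding eq by (subst card_Diff_subset) (use max_norm_ball in \<open>auto simp: max_norm_ball\<close>)
  also have "\<dots> \<le> 2 * CARD('q) * (2 * Suc r + 1) ^ (CARD('q) - 1)"
    using power_Suc_add_two_le[of "2 * r + 1" p] unfolding p by simp
  finally show ?thesis .
qed

lemma card_Gamma_lag:
  fixes n :: "nat ^ 'q::finite" and j :: "int ^ 'q"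
  shows "finite (Gamma_lag n j)"
    and "card (Gamma_lag n j) = (\<Prod>l\<in>UNIV. nat (int (n $ l) - \<bar>j $ l\<bar>))"
proof -
  have eq: "Gamma_lag n j = {i. \<forall>l. i $ l \<in> {1 + max 0 (- j $ l)..int (n $ l) - max 0 (j $ l)}}"
  proof -
    have "1 \<le> x \<and> x \<le> b \<and> 1 \<le> x + y \<and> x + y \<le> b \<longleftrightarrow> 1 + max 0 (- y) \<le> x \<and> x \<le> b - max 0 y"
      for x y b :: int by auto
    moreover have "Gamma_lag n j = {i. \<forall>l. 1 \<le> i $ l \<and> i $ l \<le> int (n $ l) \<and>
        1 \<le> i $ l + j $ l \<and> i $ l + j $ l \<le> int (n $ l)}"
      by (auto simp: Gamma_lag_def Gamma_box_def)
    ultimately show ?thesis by (simp only: atLeastAtMost_iff)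
  qed
  have "card {1 + max 0 (- j $ l)..int (n $ l) - max 0 (j $ l)} = nat (int (n $ l) - \<bar>j $ l\<bar>)" for l
    by (auto intro!: arg_cong[where f=nat])
  then show "card (Gamma_lag n j) = (\<Prod>l\<in>UNIV. nat (int (n $ l) - \<bar>j $ l\<bar>))"
    unfolding eq by (subst card_vec_box) auto
  show "finite (Gamma_lag n j)"
    unfolding eq by (rule card_vec_box) auto
qed

lemma finite_lag_box: "finite (lag_box m)"
proof -
  have "lag_box m = {k. \<forall>l. k $ l \<in> {- int (m $ l)..int (m $ l)}}"
    by (auto simp: lag_box_def abs_le_iff minus_le_iff)
  then show ?thesis by (simp only:) (rule card_vec_box, simp)
qed

lemma max_norm_lag_box: "k \<in> lag_box m \<Longrightarrow> max_norm k \<le> (MAX i. m $ i)"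
  unfolding max_norm_le_iff lag_box_def
  by (auto intro: order.trans[of _ "int (m $ _)"])

lemma card_lag_box_le: "card (lag_box (m :: nat ^ 'q::finite)) \<le> (2 * (MAX i. m $ i) + 1) ^ CARD('q)"
  unfolding max_norm_ball(2)[symmetric]
  using max_norm_lag_box by (intro card_mono max_norm_ball(1)) auto

text \<open>In the application \<open>f\<close> is \<open>sqrt \<circ> \<phi>\<close> and \<open>M\<close> is the max-norm of a lag, which has to be subtracted
  from the distance of two locations to obtain the gap between the two pairs of sites.
  The ball of radius \<open>M\<close> contributes \<open>O((M+1)\<^sup>q)\<close> terms equal to \<open>f 0 = 1\<close>.  The sphere of radius
  \<open>s + M\<close> has \<open>O((s+M)\<^bsup>q-1\<^esup>)\<close> points, and \<open>s + M \<le> s (M+1)\<close> for \<open>s \<ge> 1\<close> splits this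
  into \<open>s\<^bsup>q-1\<^esup>\<close>, which the summability hypothesis absorbs, and \<open>(M+1)\<^bsup>q-1\<^esup>\<close>.\<close>

lemma sum_max_norm_shifted_le:
  fixes f :: "nat \<Rightarrow> real"
  assumes f0: "\<And>r. 0 \<le> f r" and f1: "f 0 = 1"
    and sm: "summable (\<lambda>r. real (Suc r) ^ (CARD('q) - 1) * f (Suc r))"
  obtains C where "C > 0"
    and "\<And>M (F :: (int ^ 'q::finite) set). finite F \<Longrightarrow>
           (\<Sum>k\<in>F. f (max_norm k - M)) \<le> C * real (M + 1) ^ CARD('q)"
proof -
  let ?q = "CARD('q)"
  obtain p where p: "?q = Suc p"
    by (metis not0_implies_Suc zero_less_card_finite less_numeral_extra(3))
  define D where "D = 2 * real ?q * 3 ^ (?q - 1)"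
  define a where "a = (\<lambda>r. real (Suc r) ^ (?q - 1) * f (Suc r))"
  define C where "C = 2 ^ ?q + D * suminf a"
  have a0: "a r \<ge> 0" for r by (simp add: a_def f0)
  have D0: "D \<ge> 0" by (simp add: D_def)
  have sma: "summable a" using sm by (simp add: a_def)
  have S0: "suminf a \<ge> 0" using sma a0 by (intro suminf_nonneg) auto
  have ball: "(\<Sum>k\<in>{k :: int ^ 'q. max_norm k \<le> M + R}. f (max_norm k - M))
      \<le> real (2 * M + 1) ^ ?q + D * real (M + 1) ^ (?q - 1) * (\<Sum>r<R. a r)" for M R
  proof (induction R)
    case 0
    have "(\<Sum>k\<in>{k :: int ^ 'q. max_norm k \<le> M}. f (max_norm k - M)) =
        (\<Sum>k\<in>{k :: int ^ 'q. max_norm k \<le> M}. 1)"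
      by (intro sum.cong) (auto simp: f1)
    then show ?case by (simp add: max_norm_ball)
  next
    case (Suc R)
    let ?S = "{k :: int ^ 'q. max_norm k = Suc (M + R)}"
    have eq: "{k :: int ^ 'q. max_norm k \<le> M + Suc R} = {k. max_norm k \<le> M + R} \<union> ?S"
      by auto
    have finS: "finite ?S"
      by (rule finite_subset[OF _ max_norm_ball(1)[of "Suc (M + R)"]]) auto
    have "real (card ?S) \<le> real (2 * ?q * (2 * Suc (M + R) + 1) ^ (?q - 1))"
      using card_max_norm_sphere[of "M + R", where 'q='q] by (simp only: of_nat_le_iff)
    also have "\<dots> \<le> real (2 * ?q * (3 * (Suc R * (M + 1))) ^ (?q - 1))"
      unfolding of_nat_le_iff by (intro mult_le_mono2 power_mono) auto
    also have "\<dots> = D * real (M + 1) ^ (?q - 1) * real (Suc R) ^ (?q - 1)"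
      by (simp only: D_def of_nat_mult of_nat_power power_mult_distrib) simp
    finally have cS: "real (card ?S) \<le> D * real (M + 1) ^ (?q - 1) * real (Suc R) ^ (?q - 1)" .
    have "(\<Sum>k\<in>?S. f (max_norm k - M)) = real (card ?S) * f (Suc R)"
      by (subst sum.cong[OF refl, where h="\<lambda>_. f (Suc R)"]) (auto simp: Suc_diff_le)
    also have "\<dots> \<le> D * real (M + 1) ^ (?q - 1) * real (Suc R) ^ (?q - 1) * f (Suc R)"
      using cS f0 by (rule mult_right_mono)
    also have "\<dots> = D * real (M + 1) ^ (?q - 1) * a R"
      by (simp add: a_def)
    finally show ?case
      unfolding eq using Suc.IH finS
      by (subst sum.union_disjoint) (auto simp: max_norm_ball algebra_simps)
  qed
  show ?thesis
  proof (rule that)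
    show "C > 0" using D0 S0 by (auto simp: C_def intro!: add_pos_nonneg)
    fix M and F :: "(int ^ 'q) set" assume F: "finite F"
    \<comment> \<open>inserting \<open>0\<close> covers the empty \<open>F\<close>\<close>
    define R where "R = Max (insert 0 (max_norm ` F))"
    have R: "max_norm k \<le> M + R" if "k \<in> F" for k
      unfolding R_def using F that by (intro trans_le_add2 Max_ge) auto
    have "(\<Sum>k\<in>F. f (max_norm k - M)) \<le>
        (\<Sum>k\<in>{k :: int ^ 'q. max_norm k \<le> M + R}. f (max_norm k - M))"
      using R f0 by (intro sum_mono2) (auto simp: max_norm_ball)
    also have "\<dots> \<le> real (2 * M + 1) ^ ?q + D * real (M + 1) ^ (?q - 1) * (\<Sum>r<R. a r)"
      by (rule ball)
    also have "\<dots> \<le> (2 * real (M + 1)) ^ ?q + D * real (M + 1) ^ ?q * suminf a"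
      using a0 sma D0 S0 by (intro add_mono mult_mono power_mono power_increasing sum_le_suminf)
        (auto intro!: sum_nonneg)
    also have "\<dots> = C * real (M + 1) ^ ?q"
      by (simp only: C_def power_mult_distrib algebra_simps)
    finally show "(\<Sum>k\<in>F. f (max_norm k - M)) \<le> C * real (M + 1) ^ ?q" .
  qed
qed

section \<open>The covariance inequality for uniform mixing\<close>

text \<open>The core of Ibragimov's inequality, for two discrete variables with values \<open>a\<close> and \<open>b\<close>, joint law
  \<open>p\<close> and marginals \<open>u\<close>, \<open>v\<close>.  Cauchy--Schwarz with respect to the weights \<open>d = \<bar>p - u v\<bar>\<close> separates \<open>a\<close> from
  \<open>b\<close>.  Summing \<open>d\<close> over \<open>y\<close> gives a total variation distance, which mixing bounds by \<open>2 \<phi> u\<close>;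
  over \<open>x\<close> the trivial bound \<open>d \<le> p + u v\<close> gives \<open>2 v\<close>.  As only one factor gains \<open>\<phi>\<close>, the
  covariance gains its square root.\<close>

lemma finite_mixing_covariance:
  fixes p :: "'i \<Rightarrow> 'j \<Rightarrow> real" and a :: "'i \<Rightarrow> real" and b :: "'j \<Rightarrow> real"
  assumes fin: "finite I" "finite J" and p: "\<And>x y. 0 \<le> p x y" and \<phi>: "0 \<le> \<phi>"
    and u: "\<And>x. x \<in> I \<Longrightarrow> u x = (\<Sum>y\<in>J. p x y)"
    and v: "\<And>y. y \<in> J \<Longrightarrow> v y = (\<Sum>x\<in>I. p x y)"
    and tot: "(\<Sum>x\<in>I. u x) = 1"
    and mix: "\<And>x S. x \<in> I \<Longrightarrow> S \<subseteq> J \<Longrightarrow> \<bar>\<Sum>y\<in>S. (p x y - u x * v y)\<bar> \<le> \<phi> * u x"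
  shows "\<bar>\<Sum>x\<in>I. \<Sum>y\<in>J. a x * b y * (p x y - u x * v y)\<bar>
     \<le> 2 * sqrt \<phi> * sqrt (\<Sum>x\<in>I. (a x)\<^sup>2 * u x) * sqrt (\<Sum>y\<in>J. (b y)\<^sup>2 * v y)"
proof -
  define d where "d = (\<lambda>x y. \<bar>p x y - u x * v y\<bar>)"
  have u0: "u x \<ge> 0" if "x \<in> I" for x using u[OF that] p by (simp add: sum_nonneg)
  have v0: "v y \<ge> 0" if "y \<in> J" for y using v[OF that] p by (simp add: sum_nonneg)
  have d0: "d x y \<ge> 0" for x y by (simp add: d_def)
  \<comment> \<open>the total variation of the conditional law against the marginal one: the two signs of the
      difference are two events\<close>
  have tv: "(\<Sum>y\<in>J. d x y) \<le> 2 * \<phi> * u x" if x: "x \<in> I" for x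
  proof -
    define P where "P = {y\<in>J. p x y - u x * v y \<ge> 0}"
    have "(\<Sum>y\<in>J. d x y) = (\<Sum>y\<in>P. d x y) + (\<Sum>y\<in>J - P. d x y)"
      using fin by (subst sum.subset_diff[of P J]) (auto simp: P_def)
    also have "(\<Sum>y\<in>P. d x y) = (\<Sum>y\<in>P. p x y - u x * v y)"
      by (intro sum.cong) (auto simp: P_def d_def)
    also have "(\<Sum>y\<in>J - P. d x y) = - (\<Sum>y\<in>J - P. p x y - u x * v y)"
      unfolding sum_negf[symmetric] by (intro sum.cong) (auto simp: P_def d_def)
    finally show ?thesis
      using mix[OF x, of P] mix[OF x, of "J - P"] by (auto simp: P_def)
  qed
  have "\<bar>\<Sum>x\<in>I. \<Sum>y\<in>J. a x * b y * (p x y - u x * v y)\<bar> \<le> (\<Sum>x\<in>I. \<Sum>y\<in>J. \<bar>a x\<bar> * \<bar>b y\<bar> * d x y)"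
    by (intro order.trans[OF sum_abs] sum_mono) (auto simp: d_def abs_mult)
  also have "\<dots> = (\<Sum>(x,y)\<in>I\<times>J. (\<bar>a x\<bar> * sqrt (d x y)) * (\<bar>b y\<bar> * sqrt (d x y)))"
    unfolding sum.cartesian_product by (intro sum.cong) (auto simp: d0)
  also have "\<dots> \<le> sqrt ((\<Sum>(x,y)\<in>I\<times>J. (a x)\<^sup>2 * d x y) * (\<Sum>(x,y)\<in>I\<times>J. (b y)\<^sup>2 * d x y))"
    using Cauchy_Schwarz_ineq_sum[of "\<lambda>(x,y). \<bar>a x\<bar> * sqrt (d x y)" "\<lambda>(x,y). \<bar>b y\<bar> * sqrt (d x y)" "I\<times>J"]
    by (intro real_le_rsqrt) (simp add: case_prod_unfold power_mult_distrib d0)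
  also have "\<dots> \<le> sqrt ((2 * \<phi> * (\<Sum>x\<in>I. (a x)\<^sup>2 * u x)) * (2 * (\<Sum>y\<in>J. (b y)\<^sup>2 * v y)))"
  proof (intro real_sqrt_le_mono mult_mono)
    have "(\<Sum>(x,y)\<in>I\<times>J. (a x)\<^sup>2 * d x y) = (\<Sum>x\<in>I. (a x)\<^sup>2 * (\<Sum>y\<in>J. d x y))"
      by (simp add: sum.cartesian_product[symmetric] sum_distrib_left)
    also have "\<dots> \<le> (\<Sum>x\<in>I. (a x)\<^sup>2 * (2 * \<phi> * u x))"
      using tv by (intro sum_mono mult_left_mono) auto
    finally show "(\<Sum>(x,y)\<in>I\<times>J. (a x)\<^sup>2 * d x y) \<le> 2 * \<phi> * (\<Sum>x\<in>I. (a x)\<^sup>2 * u x)"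
      by (simp add: sum_distrib_left mult_ac)
    have "(\<Sum>x\<in>I. d x y) \<le> 2 * v y" if y: "y \<in> J" for y
    proof -
      have "(\<Sum>x\<in>I. d x y) \<le> (\<Sum>x\<in>I. p x y + u x * v y)"
        unfolding d_def using p u0 v0 y
        by (intro sum_mono order.trans[OF abs_triangle_ineq4]) (simp add: abs_mult)
      also have "\<dots> = 2 * v y"
        using tot by (simp add: sum.distrib v[OF y, symmetric] sum_distrib_right[symmetric])
      finally show ?thesis .
    qed
    then have "(\<Sum>y\<in>J. (b y)\<^sup>2 * (\<Sum>x\<in>I. d x y)) \<le> (\<Sum>y\<in>J. (b y)\<^sup>2 * (2 * v y))"
      by (intro sum_mono mult_left_mono) auto
    moreover have "(\<Sum>(x,y)\<in>I\<times>J. (b y)\<^sup>2 * d x y) = (\<Sum>y\<in>J. (b y)\<^sup>2 * (\<Sum>x\<in>I. d x y))"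
      by (simp add: sum.cartesian_product[symmetric] sum_distrib_left) (rule sum.swap)
    ultimately show "(\<Sum>(x,y)\<in>I\<times>J. (b y)\<^sup>2 * d x y) \<le> 2 * (\<Sum>y\<in>J. (b y)\<^sup>2 * v y)"
      by (simp add: sum_distrib_left mult_ac)
  qed (use u0 \<phi> d0 in \<open>auto intro!: sum_nonneg mult_nonneg_nonneg\<close>)
  also have "\<dots> = 2 * sqrt \<phi> * sqrt (\<Sum>x\<in>I. (a x)\<^sup>2 * u x) * sqrt (\<Sum>y\<in>J. (b y)\<^sup>2 * v y)"
  proof -
    have "(2 * \<phi> * A) * (2 * B) = 2\<^sup>2 * (\<phi> * A * B)" for A B :: real by (simp add: power2_eq_square)
    then show ?thesis by (simp add: real_sqrt_mult)
  qed
  finally show ?thesis .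
qed

text \<open>The finite inequality applies to the level sets of \<open>s\<close> and \<open>t\<close>; a sum over finitely many values of
  \<open>t\<close> is a statement about one event of \<open>G\<close>, their union, and so is controlled by \<open>mix\<close>.\<close>

lemma (in prob_space) simple_mixing_covariance:
  fixes s t :: "'a \<Rightarrow> real"
  assumes F: "subalgebra M F" and G: "subalgebra M G" and \<phi>: "0 \<le> \<phi>"
    and mix: "\<And>A B. A \<in> sets F \<Longrightarrow> B \<in> sets G \<Longrightarrow>
                \<bar>prob (B \<inter> A) - prob A * prob B\<bar> \<le> \<phi> * prob A"
    and s: "simple_function F s" and t: "simple_function G t"
  shows "\<bar>expectation (\<lambda>\<omega>. s \<omega> * t \<omega>) - expectation s * expectation t\<bar>
     \<le> 2 * sqrt \<phi> * sqrt (expectation (\<lambda>\<omega>. (s \<omega>)\<^sup>2)) * sqrt (expectation (\<lambda>\<omega>. (t \<omega>)\<^sup>2))"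
proof -
  have spF: "space F = space M" "sets F \<subseteq> sets M" and spG: "space G = space M" "sets G \<subseteq> sets M"
    using F G by (auto simp: subalgebra_def)
  define I where "I = s ` space M"
  define J where "J = t ` space M"
  define A where "A = (\<lambda>x. s -` {x} \<inter> space M)"
  define B where "B = (\<lambda>y. t -` {y} \<inter> space M)"
  have fin: "finite I" "finite J"
    using s t by (auto simp: I_def J_def simple_function_def spF spG)
  have AF: "A x \<in> sets F" for x using simple_functionD(2)[OF s, of "{x}"] by (simp add: A_def spF)
  have BG: "B y \<in> sets G" for y using simple_functionD(2)[OF t, of "{y}"] by (simp add: B_def spG)
  have AM [measurable]: "A x \<in> sets M" for x using AF spF by auto
  have BM [measurable]: "B y \<in> sets M" for y using BG spG by auto
  have expand: "expectation (\<lambda>\<omega>. h (s \<omega>) (t \<omega>)) = (\<Sum>x\<in>I. \<Sum>y\<in>J. h x y * prob (A x \<inter> B y))"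
    for h :: "real \<Rightarrow> real \<Rightarrow> real"
  proof -
    have "h (s \<omega>) (t \<omega>) = (\<Sum>x\<in>I. \<Sum>y\<in>J. h x y * indicator (A x \<inter> B y) \<omega>)"
      if "\<omega> \<in> space M" for \<omega>
    proof -
      have "(\<Sum>x\<in>I. \<Sum>y\<in>J. h x y * indicator (A x \<inter> B y) \<omega>) =
            (\<Sum>x\<in>I. \<Sum>y\<in>J. if y = t \<omega> then (if x = s \<omega> then h x y else 0) else 0)"
        using that by (intro sum.cong refl) (auto simp: A_def B_def indicator_def)
      also have "\<dots> = h (s \<omega>) (t \<omega>)"
        using fin that by (simp add: sum.delta) (simp add: I_def J_def)
      finally show ?thesis ..
    qed
    then have "expectation (\<lambda>\<omega>. h (s \<omega>) (t \<omega>)) =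
        expectation (\<lambda>\<omega>. \<Sum>x\<in>I. \<Sum>y\<in>J. h x y * indicator (A x \<inter> B y) \<omega>)"
      by (intro Bochner_Integration.integral_cong) auto
    also have "\<dots> = (\<Sum>x\<in>I. \<Sum>y\<in>J. h x y * prob (A x \<inter> B y))"
      by (subst Bochner_Integration.integral_sum | simp add: emeasure_eq_measure)+
    finally show ?thesis .
  qed
  define p where "p = (\<lambda>x y. prob (A x \<inter> B y))"
  have disjB: "disjoint_family_on B S" for S by (auto simp: disjoint_family_on_def B_def)
  have disjAB: "disjoint_family_on (\<lambda>x. A x \<inter> B y) S" "disjoint_family_on (\<lambda>y. A x \<inter> B y) S" for S x y
    by (auto simp: disjoint_family_on_def A_def B_def)
  have u: "prob (A x) = (\<Sum>y\<in>J. p x y)" if "x \<in> I" for x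
  proof -
    have "A x = (\<Union>y\<in>J. A x \<inter> B y)" by (auto simp: A_def B_def J_def)
    moreover have "prob (\<Union>y\<in>J. A x \<inter> B y) = (\<Sum>y\<in>J. prob (A x \<inter> B y))"
      using fin by (intro finite_measure_finite_Union disjAB) auto
    ultimately show ?thesis by (simp add: p_def)
  qed
  have v: "prob (B y) = (\<Sum>x\<in>I. p x y)" if "y \<in> J" for y
  proof -
    have "B y = (\<Union>x\<in>I. A x \<inter> B y)" by (auto simp: A_def B_def I_def)
    moreover have "prob (\<Union>x\<in>I. A x \<inter> B y) = (\<Sum>x\<in>I. prob (A x \<inter> B y))"
      using fin by (intro finite_measure_finite_Union disjAB) auto
    ultimately show ?thesis by (simp add: p_def)
  qed
  have Es: "expectation (\<lambda>\<omega>. h (s \<omega>)) = (\<Sum>x\<in>I. h x * prob (A x))" for h :: "real \<Rightarrow> real"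
    using expand[of "\<lambda>x y. h x"] by (simp add: u p_def sum_distrib_left)
  have Et: "expectation (\<lambda>\<omega>. h (t \<omega>)) = (\<Sum>y\<in>J. h y * prob (B y))" for h :: "real \<Rightarrow> real"
    using expand[of "\<lambda>x y. h y"] by (subst (asm) sum.swap) (simp add: v p_def sum_distrib_left)
  have tot: "(\<Sum>x\<in>I. prob (A x)) = 1" using Es[of "\<lambda>_. 1"] by (simp add: prob_space)
  have mix': "\<bar>\<Sum>y\<in>S. (p x y - prob (A x) * prob (B y))\<bar> \<le> \<phi> * prob (A x)"
    if x: "x \<in> I" and S: "S \<subseteq> J" for x S
  proof -
    have fS: "finite S" using S fin finite_subset by blast
    have "(\<Sum>y\<in>S. p x y) = prob (\<Union>y\<in>S. A x \<inter> B y)" unfolding p_def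
      using fS by (intro finite_measure_finite_Union[symmetric] disjAB disjB) auto
    also have "(\<Union>y\<in>S. A x \<inter> B y) = (\<Union>y\<in>S. B y) \<inter> A x" by auto
    finally have 1: "(\<Sum>y\<in>S. p x y) = prob ((\<Union>y\<in>S. B y) \<inter> A x)" .
    have 2: "(\<Sum>y\<in>S. prob (B y)) = prob (\<Union>y\<in>S. B y)"
      using fS by (intro finite_measure_finite_Union[symmetric] disjAB disjB) auto
    have "(\<Union>y\<in>S. B y) \<in> sets G" using fS BG by auto
    from mix[OF AF this] show ?thesis
      by (simp add: sum_subtractf 1 sum_distrib_left[symmetric] 2)
  qed
  have "expectation (\<lambda>\<omega>. s \<omega> * t \<omega>) - expectation s * expectation t =
      (\<Sum>x\<in>I. \<Sum>y\<in>J. x * y * (p x y - prob (A x) * prob (B y)))"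
    using expand[of "\<lambda>x y. x * y"] Es[of "\<lambda>x. x"] Et[of "\<lambda>x. x"]
    by (simp add: p_def right_diff_distrib sum_subtractf sum_product mult_ac)
  also have "\<bar>\<dots>\<bar> \<le> 2 * sqrt \<phi> * sqrt (\<Sum>x\<in>I. x\<^sup>2 * prob (A x)) * sqrt (\<Sum>y\<in>J. y\<^sup>2 * prob (B y))"
    by (rule finite_mixing_covariance) (use fin \<phi> u v tot mix' in \<open>auto simp: p_def\<close>)
  finally show ?thesis
    using Es[of "\<lambda>x. x\<^sup>2"] Et[of "\<lambda>x. x\<^sup>2"] by simp
qed

lemma integrable_mult_of_squares:
  fixes f g :: "'a \<Rightarrow> real"
  assumes [measurable]: "f \<in> borel_measurable M" "g \<in> borel_measurable M"
    and "integrable M (\<lambda>x. (f x)\<^sup>2)" "integrable M (\<lambda>x. (g x)\<^sup>2)"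
  shows "integrable M (\<lambda>x. f x * g x)"
proof (rule Bochner_Integration.integrable_bound)
  show "integrable M (\<lambda>x. (f x)\<^sup>2 + (g x)\<^sup>2)" using assms by simp
  have "\<bar>f x * g x\<bar> \<le> (f x)\<^sup>2 + (g x)\<^sup>2" for x
    using sum_squares_bound[of "\<bar>f x\<bar>" "\<bar>g x\<bar>"] abs_ge_zero[of "f x * g x"]
    unfolding abs_mult power2_abs by linarith
  then show "AE x in M. norm (f x * g x) \<le> norm ((f x)\<^sup>2 + (g x)\<^sup>2)" by simp
qed measurable

text \<open>Approximation of \<open>X\<close> and \<open>Y\<close> by simple functions that are dominated by \<open>2 \<bar>X\<bar>\<close> and \<open>2 \<bar>Y\<bar>\<close>: square
  integrability then provides the majorants for all five expectations.\<close>

lemma (in prob_space) mixing_covariance: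
  fixes X Y :: "'a \<Rightarrow> real"
  assumes F: "subalgebra M F" and G: "subalgebra M G" and \<phi>: "0 \<le> \<phi>"
    and mix: "\<And>A B. A \<in> sets F \<Longrightarrow> B \<in> sets G \<Longrightarrow>
                \<bar>prob (B \<inter> A) - prob A * prob B\<bar> \<le> \<phi> * prob A"
    and X: "X \<in> borel_measurable F" and Y: "Y \<in> borel_measurable G"
    and X2: "integrable M (\<lambda>\<omega>. (X \<omega>)\<^sup>2)" and Y2: "integrable M (\<lambda>\<omega>. (Y \<omega>)\<^sup>2)"
  shows "\<bar>expectation (\<lambda>\<omega>. X \<omega> * Y \<omega>) - expectation X * expectation Y\<bar>
     \<le> 2 * sqrt \<phi> * sqrt (expectation (\<lambda>\<omega>. (X \<omega>)\<^sup>2)) * sqrt (expectation (\<lambda>\<omega>. (Y \<omega>)\<^sup>2))"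
proof -
  have [measurable]: "X \<in> borel_measurable M" "Y \<in> borel_measurable M"
    using measurable_from_subalg[OF F X] measurable_from_subalg[OF G Y] .
  have sp: "space F = space M" "space G = space M" using F G by (auto simp: subalgebra_def)
  obtain s where s: "\<And>i. simple_function F (s i)"
    "\<And>\<omega>. \<omega> \<in> space M \<Longrightarrow> (\<lambda>i. s i \<omega>) \<longlonglongrightarrow> X \<omega>" "\<And>i \<omega>. \<omega> \<in> space M \<Longrightarrow> \<bar>s i \<omega>\<bar> \<le> 2 * \<bar>X \<omega>\<bar>"
    using borel_measurable_implies_sequence_metric[OF X, of 0] by (simp add: sp dist_real_def) blast
  obtain t where t: "\<And>i. simple_function G (t i)"
    "\<And>\<omega>. \<omega> \<in> space M \<Longrightarrow> (\<lambda>i. t i \<omega>) \<longlonglongrightarrow> Y \<omega>" "\<And>i \<omega>. \<omega> \<in> space M \<Longrightarrow> \<bar>t i \<omega>\<bar> \<le> 2 * \<bar>Y \<omega>\<bar>"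
    using borel_measurable_implies_sequence_metric[OF Y, of 0] by (simp add: sp dist_real_def) blast
  have [measurable]: "s i \<in> borel_measurable M" "t i \<in> borel_measurable M" for i
    using measurable_from_subalg[OF F borel_measurable_simple_function[OF s(1)]]
          measurable_from_subalg[OF G borel_measurable_simple_function[OF t(1)]] .
  have iX: "integrable M X" and iY: "integrable M Y"
    using X2 Y2 by (auto intro: square_integrable_imp_integrable)
  have iXY: "integrable M (\<lambda>\<omega>. X \<omega> * Y \<omega>)"
    using X2 Y2 by (intro integrable_mult_of_squares) auto
  have lim: "(\<lambda>i. expectation (\<lambda>\<omega>. f i \<omega>)) \<longlonglongrightarrow> expectation f0"
    if "\<And>i. f i \<in> borel_measurable M" "f0 \<in> borel_measurable M" "integrable M w"
      "\<And>\<omega>. \<omega> \<in> space M \<Longrightarrow> (\<lambda>i. f i \<omega>) \<longlonglongrightarrow> f0 \<omega>" "\<And>i \<omega>. \<omega> \<in> space M \<Longrightarrow> \<bar>f i \<omega>\<bar> \<le> w \<omega>"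
    for f :: "nat \<Rightarrow> 'a \<Rightarrow> real" and f0 w
    using that by (intro integral_dominated_convergence[where w=w]) auto
  have sq: "\<bar>x\<^sup>2\<bar> \<le> 4 * y\<^sup>2" if "\<bar>x\<bar> \<le> 2 * \<bar>y\<bar>" for x y :: real
    using power_mono[OF that, of 2] by simp
  have Ls: "(\<lambda>i. expectation (s i)) \<longlonglongrightarrow> expectation X"
    by (rule lim[of _ _ "\<lambda>\<omega>. 2 * \<bar>X \<omega>\<bar>"]) (use s iX in auto)
  have Lt: "(\<lambda>i. expectation (t i)) \<longlonglongrightarrow> expectation Y"
    by (rule lim[of _ _ "\<lambda>\<omega>. 2 * \<bar>Y \<omega>\<bar>"]) (use t iY in auto)
  have Ls2: "(\<lambda>i. expectation (\<lambda>\<omega>. (s i \<omega>)\<^sup>2)) \<longlonglongrightarrow> expectation (\<lambda>\<omega>. (X \<omega>)\<^sup>2)"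
    by (rule lim[of _ _ "\<lambda>\<omega>. 4 * (X \<omega>)\<^sup>2"]) (use s X2 sq in \<open>auto intro!: tendsto_intros\<close>)
  have Lt2: "(\<lambda>i. expectation (\<lambda>\<omega>. (t i \<omega>)\<^sup>2)) \<longlonglongrightarrow> expectation (\<lambda>\<omega>. (Y \<omega>)\<^sup>2)"
    by (rule lim[of _ _ "\<lambda>\<omega>. 4 * (Y \<omega>)\<^sup>2"]) (use t Y2 sq in \<open>auto intro!: tendsto_intros\<close>)
  have Lst: "(\<lambda>i. expectation (\<lambda>\<omega>. s i \<omega> * t i \<omega>)) \<longlonglongrightarrow> expectation (\<lambda>\<omega>. X \<omega> * Y \<omega>)"
  proof (rule lim[of _ _ "\<lambda>\<omega>. 4 * \<bar>X \<omega> * Y \<omega>\<bar>"])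
    show "\<bar>s i \<omega> * t i \<omega>\<bar> \<le> 4 * \<bar>X \<omega> * Y \<omega>\<bar>" if "\<omega> \<in> space M" for i \<omega>
      using mult_mono[OF s(3)[OF that, of i] t(3)[OF that, of i]] by (simp add: abs_mult)
  qed (use s t iXY in \<open>auto intro!: tendsto_intros\<close>)
  show ?thesis
  proof (rule LIMSEQ_le)
    show "(\<lambda>i. \<bar>expectation (\<lambda>\<omega>. s i \<omega> * t i \<omega>) - expectation (s i) * expectation (t i)\<bar>)
        \<longlonglongrightarrow> \<bar>expectation (\<lambda>\<omega>. X \<omega> * Y \<omega>) - expectation X * expectation Y\<bar>"
      by (intro tendsto_intros Lst Ls Lt)
    show "(\<lambda>i. 2 * sqrt \<phi> * sqrt (expectation (\<lambda>\<omega>. (s i \<omega>)\<^sup>2)) * sqrt (expectation (\<lambda>\<omega>. (t i \<omega>)\<^sup>2)))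
        \<longlonglongrightarrow> 2 * sqrt \<phi> * sqrt (expectation (\<lambda>\<omega>. (X \<omega>)\<^sup>2)) * sqrt (expectation (\<lambda>\<omega>. (Y \<omega>)\<^sup>2))"
      by (intro tendsto_intros Ls2 Lt2)
    show "\<exists>N. \<forall>i\<ge>N. \<bar>expectation (\<lambda>\<omega>. s i \<omega> * t i \<omega>) - expectation (s i) * expectation (t i)\<bar>
      \<le> 2 * sqrt \<phi> * sqrt (expectation (\<lambda>\<omega>. (s i \<omega>)\<^sup>2)) * sqrt (expectation (\<lambda>\<omega>. (t i \<omega>)\<^sup>2))"
      using simple_mixing_covariance[OF F G \<phi> mix s(1) t(1)] by blast
  qed
qed

lemma (in prob_space) expectation_abs_le_sqrt:
  assumes "X \<in> borel_measurable M" "integrable M (\<lambda>\<omega>. (X \<omega>)\<^sup>2)"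
  shows "expectation (\<lambda>\<omega>. \<bar>X \<omega>\<bar>) \<le> sqrt (expectation (\<lambda>\<omega>. (X \<omega>)\<^sup>2))"
proof (rule real_le_rsqrt)
  have "integrable M X" using assms by (rule square_integrable_imp_integrable)
  then have "variance (\<lambda>\<omega>. \<bar>X \<omega>\<bar>) = expectation (\<lambda>\<omega>. \<bar>X \<omega>\<bar>\<^sup>2) - (expectation (\<lambda>\<omega>. \<bar>X \<omega>\<bar>))\<^sup>2"
    using assms by (intro variance_eq) auto
  then show "(expectation (\<lambda>\<omega>. \<bar>X \<omega>\<bar>))\<^sup>2 \<le> expectation (\<lambda>\<omega>. (X \<omega>)\<^sup>2)"
    using variance_positive[of "\<lambda>\<omega>. \<bar>X \<omega>\<bar>"] by simp
qed

section \<open>Covariances of a stationary mixing field\<close>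

text \<open>Every pair of \<open>\<sigma>\<close>-algebras mixes with coefficient \<open>1\<close>; this is what justifies the convention
  \<open>\<phi> 0 = 1\<close> in the bounds below.\<close>

lemma (in prob_space) abs_prob_Int_minus_product_le:
  assumes "A \<in> sets M"
  shows "\<bar>prob (B \<inter> A) - prob A * prob B\<bar> \<le> prob A"
proof -
  have "0 \<le> prob A * prob B" "prob A * prob B \<le> prob A" by (auto simp: mult_left_le)
  moreover have "0 \<le> prob (B \<inter> A)" "prob (B \<inter> A) \<le> prob A"
    using assms by (auto intro!: finite_measure_mono)
  ultimately show ?thesis by linarith
qed

locale stationary_field = prob_space M
  for M :: "'a measure" and \<xi> :: "int ^ 'q::finite \<Rightarrow> 'a \<Rightarrow> real" +
  assumes rv [measurable]: "\<And>i. \<xi> i \<in> borel_measurable M"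
    and stationary: "strictly_stationary M \<xi>"
    and fourth_moment: "integrable M (\<lambda>\<omega>. \<xi> 0 \<omega> ^ 4)"
begin

abbreviation "\<phi> \<equiv> phi_mix M \<xi>"
abbreviation "K \<equiv> expectation (\<lambda>\<omega>. \<xi> 0 \<omega> ^ 4)"

definition autocov :: "int ^ 'q \<Rightarrow> real" where
  "autocov k = expectation (\<lambda>\<omega>. \<xi> 0 \<omega> * \<xi> k \<omega>)"

text \<open>The \<open>\<sigma>\<close>-algebra generated by the sites in \<open>S\<close>, as a measure space (with the zero measure), so that
  measurability with respect to it is expressible as membership in \<open>borel_measurable\<close>.\<close>

definition field_algebra :: "(int ^ 'q) set \<Rightarrow> 'a measure" where
  "field_algebra S = sigma (space M) {\<xi> n -` B \<inter> space M | n B. n \<in> S \<and> B \<in> sets borel}"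

lemma sets_field_algebra: "sets (field_algebra S) = field_sigma M \<xi> S"
  unfolding field_algebra_def field_sigma_def by (intro sets_measure_of) auto

lemma space_field_algebra [simp]: "space (field_algebra S) = space M"
  unfolding field_algebra_def by (intro space_measure_of) auto

lemma subalgebra_field_algebra: "subalgebra M (field_algebra S)"
proof -
  have "field_sigma M \<xi> S \<subseteq> sets M"
    unfolding field_sigma_def by (intro sets.sigma_sets_subset) (auto intro: measurable_sets)
  then show ?thesis by (simp add: subalgebra_def sets_field_algebra)
qed

lemma measurable_field_algebra: "i \<in> S \<Longrightarrow> \<xi> i \<in> borel_measurable (field_algebra S)"
  unfolding measurable_def
  by (auto simp: sets_field_algebra field_sigma_def intro!: sigma_sets.Basic)

text \<open>The supremum over events with positive probability becomes a bound for all \<open>A\<close> after multiplication by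
  \<open>prob A\<close>; at \<open>r = 0\<close>, where \<open>\<phi>\<close> is \<open>1\<close> by convention, it is the trivial bound.\<close>

lemma phi_mix_bound:
  assumes A: "A \<in> sets (field_algebra {n. n $ l \<le> 0})"
    and B: "B \<in> sets (field_algebra {n. n $ l \<ge> int r})"
  shows "\<bar>prob (B \<inter> A) - prob A * prob B\<bar> \<le> \<phi> r * prob A"
proof -
  have [measurable]: "A \<in> sets M" "B \<in> sets M"
    using A B subalgebra_field_algebra unfolding subalgebra_def by blast+
  have le: "prob (B' \<inter> A') \<le> prob A'" "0 \<le> prob (B' \<inter> A')" if "A' \<in> sets M" for A' B'
    using that by (auto intro!: finite_measure_mono)
  show ?thesis
  proof (cases "r = 0")
    case True
    then show ?thesis using abs_prob_Int_minus_product_le[of A B] by (simp add: phi_mix_def)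
  next
    case False
    show ?thesis
    proof (cases "prob A = 0")
      case True
      then show ?thesis using le[of A B] by simp
    next
      case nz: False
      then have pos: "prob A > 0" by (simp add: zero_less_measure_iff)
      let ?T = "{\<bar>measure M (B \<inter> A) / measure M A - measure M B\<bar> | A B.
            A \<in> sigma_minus M \<xi> l 0 \<and> B \<in> sigma_plus M \<xi> l r \<and> measure M A > 0}"
      have bdd: "bdd_above ?T"
      proof (rule bdd_aboveI[of _ 1])
        fix x assume "x \<in> ?T"
        then obtain A' B' where x: "x = \<bar>prob (B' \<inter> A') / prob A' - prob B'\<bar>"
          and A': "A' \<in> sigma_minus M \<xi> l 0" and p: "prob A' > 0" by auto
        have "A' \<in> sets M"
          using A' subalgebra_field_algebra[of "{n. n $ l \<le> int 0}"]
          unfolding subalgebra_def sets_field_algebra sigma_minus_def by blast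
        then have "prob (B' \<inter> A') / prob A' \<le> 1" "0 \<le> prob (B' \<inter> A') / prob A'"
          using le[of A' B'] p by auto
        moreover have "0 \<le> prob B'" "prob B' \<le> 1" by auto
        ultimately show "x \<le> 1" unfolding x by linarith
      qed
      have "\<bar>prob (B \<inter> A) / prob A - prob B\<bar> \<le> phi_dir M \<xi> l r"
        unfolding phi_dir_def using A B pos
        by (intro cSup_upper bdd) (auto simp: sigma_minus_def sigma_plus_def sets_field_algebra)
      also have "\<dots> \<le> \<phi> r"
        using False by (auto simp: phi_mix_def intro!: Max_ge)
      finally have "\<bar>prob (B \<inter> A) / prob A - prob B\<bar> * prob A \<le> \<phi> r * prob A"
        using pos by (intro mult_right_mono) auto
      moreover have "\<bar>prob (B \<inter> A) / prob A - prob B\<bar> * prob A = \<bar>prob (B \<inter> A) - prob A * prob B\<bar>"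
      proof -
        have "\<bar>prob (B \<inter> A) / prob A - prob B\<bar> * prob A =
            \<bar>(prob (B \<inter> A) / prob A - prob B) * prob A\<bar>"
          by (simp add: abs_mult)
        also have "(prob (B \<inter> A) / prob A - prob B) * prob A = prob (B \<inter> A) - prob A * prob B"
          using pos by (simp add: field_simps)
        finally show ?thesis .
      qed
      ultimately show ?thesis by simp
    qed
  qed
qed

lemma phi_mix_nonneg: "0 \<le> \<phi> r"
proof -
  have "space M \<in> sets (field_algebra S)" for S
    using sets.top[of "field_algebra S"] by simp
  from phi_mix_bound[OF this this, where r=r] show ?thesis by (simp add: prob_space)
qed

lemma half_space_covariance:
  assumes "X \<in> borel_measurable (field_algebra {n. n $ l \<le> 0})"
    and "Y \<in> borel_measurable (field_algebra {n. n $ l \<ge> int r})"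
    and "integrable M (\<lambda>\<omega>. (X \<omega>)\<^sup>2)" "integrable M (\<lambda>\<omega>. (Y \<omega>)\<^sup>2)"
    and "expectation (\<lambda>\<omega>. (X \<omega>)\<^sup>2) \<le> V" "expectation (\<lambda>\<omega>. (Y \<omega>)\<^sup>2) \<le> V"
  shows "\<bar>expectation (\<lambda>\<omega>. X \<omega> * Y \<omega>) - expectation X * expectation Y\<bar> \<le> 2 * V * sqrt (\<phi> r)"
proof -
  have V: "0 \<le> V" using assms(5) by (meson Bochner_Integration.integral_nonneg order_trans zero_le_power2)
  have "\<bar>expectation (\<lambda>\<omega>. X \<omega> * Y \<omega>) - expectation X * expectation Y\<bar>
     \<le> 2 * sqrt (\<phi> r) * sqrt (expectation (\<lambda>\<omega>. (X \<omega>)\<^sup>2)) * sqrt (expectation (\<lambda>\<omega>. (Y \<omega>)\<^sup>2))"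
    by (rule mixing_covariance[OF subalgebra_field_algebra subalgebra_field_algebra phi_mix_nonneg
          phi_mix_bound]) (use assms in auto)
  also have "\<dots> \<le> 2 * sqrt (\<phi> r) * sqrt V * sqrt V"
    using assms V phi_mix_nonneg by (intro mult_mono real_sqrt_le_mono) auto
  also have "\<dots> = 2 * V * sqrt (\<phi> r)"
    using real_sqrt_mult_self[of V] V by simp
  finally show ?thesis .
qed

lemma shift_expectation:
  assumes "finite I" and F [measurable]: "F \<in> borel_measurable (\<Pi>\<^sub>M i\<in>I. borel)"
  shows "expectation (\<lambda>\<omega>. F (\<lambda>i\<in>I. \<xi> (i + h) \<omega>)) = expectation (\<lambda>\<omega>. F (\<lambda>i\<in>I. \<xi> i \<omega>) :: real)"
    and "integrable M (\<lambda>\<omega>. F (\<lambda>i\<in>I. \<xi> i \<omega>)) \<Longrightarrow> integrable M (\<lambda>\<omega>. F (\<lambda>i\<in>I. \<xi> (i + h) \<omega>))"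
proof -
  have eq: "distr M (\<Pi>\<^sub>M i\<in>I. borel) (\<lambda>\<omega>. \<lambda>i\<in>I. \<xi> (i + h) \<omega>) =
        distr M (\<Pi>\<^sub>M i\<in>I. borel) (\<lambda>\<omega>. \<lambda>i\<in>I. \<xi> i \<omega>)"
    using stationary assms(1) by (simp add: strictly_stationary_def)
  show "expectation (\<lambda>\<omega>. F (\<lambda>i\<in>I. \<xi> (i + h) \<omega>)) = expectation (\<lambda>\<omega>. F (\<lambda>i\<in>I. \<xi> i \<omega>))"
    using arg_cong[OF eq, of "\<lambda>N. integral\<^sup>L N F"] by (simp add: integral_distr)
  show "integrable M (\<lambda>\<omega>. F (\<lambda>i\<in>I. \<xi> (i + h) \<omega>))" if "integrable M (\<lambda>\<omega>. F (\<lambda>i\<in>I. \<xi> i \<omega>))"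
    using that arg_cong[OF eq, of "\<lambda>N. integrable N F"] by (simp add: integrable_distr_eq)
qed

lemma fourth_moment_at:
  "integrable M (\<lambda>\<omega>. \<xi> i \<omega> ^ 4)" "expectation (\<lambda>\<omega>. \<xi> i \<omega> ^ 4) = K"
  using shift_expectation[of "{0}" "\<lambda>x. x 0 ^ 4" i] fourth_moment by simp_all

lemma shift_two: "expectation (\<lambda>\<omega>. \<xi> (a + h) \<omega> * \<xi> (b + h) \<omega>) = expectation (\<lambda>\<omega>. \<xi> a \<omega> * \<xi> b \<omega>)"
  using shift_expectation(1)[of "{a, b}" "\<lambda>x. x a * x b" h] by simp

lemma shift_four:
  "expectation (\<lambda>\<omega>. (\<xi> (a + h) \<omega> * \<xi> (b + h) \<omega>) * (\<xi> (c + h) \<omega> * \<xi> (d + h) \<omega>)) =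
   expectation (\<lambda>\<omega>. (\<xi> a \<omega> * \<xi> b \<omega>) * (\<xi> c \<omega> * \<xi> d \<omega>))"
  using shift_expectation(1)[of "{a, b, c, d}" "\<lambda>x. (x a * x b) * (x c * x d)" h] by simp

lemma expectation_lag: "expectation (\<lambda>\<omega>. \<xi> i \<omega> * \<xi> (i + j) \<omega>) = autocov j"
  using shift_two[of 0 i j] by (simp add: autocov_def add.commute)

lemma autocov_minus: "autocov (- k) = autocov k"
  using shift_two[of "- k" k 0] by (simp add: autocov_def mult.commute)

lemma square_integrable_product:
  "integrable M (\<lambda>\<omega>. (\<xi> a \<omega> * \<xi> b \<omega>)\<^sup>2)" "expectation (\<lambda>\<omega>. (\<xi> a \<omega> * \<xi> b \<omega>)\<^sup>2) \<le> K"
proof -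
  have le: "(x * y)\<^sup>2 \<le> (x ^ 4 + y ^ 4) / 2" for x y :: real
    using sum_squares_bound[of "x\<^sup>2" "y\<^sup>2"] by (simp add: power_mult_distrib)
  show int: "integrable M (\<lambda>\<omega>. (\<xi> a \<omega> * \<xi> b \<omega>)\<^sup>2)"
  proof (rule Bochner_Integration.integrable_bound)
    show "integrable M (\<lambda>\<omega>. (\<xi> a \<omega> ^ 4 + \<xi> b \<omega> ^ 4) / 2)" by (simp add: fourth_moment_at(1))
    show "AE \<omega> in M. norm ((\<xi> a \<omega> * \<xi> b \<omega>)\<^sup>2) \<le> norm ((\<xi> a \<omega> ^ 4 + \<xi> b \<omega> ^ 4) / 2)"
      using le by (auto intro: order.trans[OF _ abs_ge_self])
  qed measurable
  have "expectation (\<lambda>\<omega>. (\<xi> a \<omega> * \<xi> b \<omega>)\<^sup>2) \<le> expectation (\<lambda>\<omega>. (\<xi> a \<omega> ^ 4 + \<xi> b \<omega> ^ 4) / 2)"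
  proof (rule integral_mono[OF int])
    show "integrable M (\<lambda>\<omega>. (\<xi> a \<omega> ^ 4 + \<xi> b \<omega> ^ 4) / 2)" by (simp add: fourth_moment_at(1))
  qed (rule le)
  also have "\<dots> = (expectation (\<lambda>\<omega>. \<xi> a \<omega> ^ 4) + expectation (\<lambda>\<omega>. \<xi> b \<omega> ^ 4)) / 2"
    by (simp add: fourth_moment_at(1))
  also have "\<dots> = K" by (simp add: fourth_moment_at(2)[of a] fourth_moment_at(2)[of b])
  finally show "expectation (\<lambda>\<omega>. (\<xi> a \<omega> * \<xi> b \<omega>)\<^sup>2) \<le> K" .
qed

lemma integrable_product: "integrable M (\<lambda>\<omega>. \<xi> a \<omega> * \<xi> b \<omega>)"
  by (rule square_integrable_imp_integrable[OF _ square_integrable_product(1)]) measurable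

lemma integrable_four: "integrable M (\<lambda>\<omega>. (\<xi> a \<omega> * \<xi> b \<omega>) * (\<xi> c \<omega> * \<xi> d \<omega>))"
  by (intro integrable_mult_of_squares square_integrable_product) measurable

lemma K_nonneg: "0 \<le> K" by (intro Bochner_Integration.integral_nonneg) simp

text \<open>Up to replacing \<open>k\<close> by \<open>-k\<close>, some coordinate of \<open>k\<close> equals its max-norm, so that the hyperplanes
  through \<open>0\<close> and through \<open>k\<close> are that far apart.\<close>

lemma autocov_bound:
  assumes centred: "expectation (\<xi> 0) = 0"
  shows "\<bar>autocov k\<bar> \<le> 2 * autocov 0 * sqrt (\<phi> (max_norm k))"
proof -
  have pos: "\<bar>autocov k\<bar> \<le> 2 * autocov 0 * sqrt (\<phi> (max_norm k))" if "k $ l = int (max_norm k)" for k l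
  proof -
    have "\<bar>expectation (\<lambda>\<omega>. \<xi> 0 \<omega> * \<xi> k \<omega>) - expectation (\<xi> 0) * expectation (\<xi> k)\<bar>
        \<le> 2 * autocov 0 * sqrt (\<phi> (max_norm k))"
    proof (rule half_space_covariance)
      show "integrable M (\<lambda>\<omega>. (\<xi> 0 \<omega>)\<^sup>2)" "integrable M (\<lambda>\<omega>. (\<xi> k \<omega>)\<^sup>2)"
        using integrable_product[of 0 0] integrable_product[of k k] by (simp_all add: power2_eq_square)
      show "expectation (\<lambda>\<omega>. (\<xi> 0 \<omega>)\<^sup>2) \<le> autocov 0" "expectation (\<lambda>\<omega>. (\<xi> k \<omega>)\<^sup>2) \<le> autocov 0"
        using expectation_lag[of 0 0] expectation_lag[of k 0] by (simp_all add: power2_eq_square)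
      show "\<xi> 0 \<in> borel_measurable (field_algebra {n. n $ l \<le> 0})"
           "\<xi> k \<in> borel_measurable (field_algebra {n. n $ l \<ge> int (max_norm k)})"
        using that by (auto intro!: measurable_field_algebra)
    qed
    then show ?thesis by (simp add: centred autocov_def)
  qed
  obtain l where "int (max_norm k) = \<bar>k $ l\<bar>" using max_norm_attained by blast
  then consider "k $ l = int (max_norm k)" | "(- k) $ l = int (max_norm (- k))" by fastforce
  then show ?thesis
    using pos[of k l] pos[of "- k" l] by cases (simp_all only: autocov_minus max_norm_minus)
qed

text \<open>The mixing coefficients only compare the half-space below the hyperplane at level \<open>0\<close> with the one above
  level \<open>r\<close>; stationarity moves the level \<open>t\<close> to the origin.\<close>

lemma covariance_products_separated:
  assumes "a $ l \<le> t" "b $ l \<le> t" "t + int r \<le> c $ l" "t + int r \<le> d $ l"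
  shows "\<bar>expectation (\<lambda>\<omega>. (\<xi> a \<omega> * \<xi> b \<omega>) * (\<xi> c \<omega> * \<xi> d \<omega>))
            - expectation (\<lambda>\<omega>. \<xi> a \<omega> * \<xi> b \<omega>) * expectation (\<lambda>\<omega>. \<xi> c \<omega> * \<xi> d \<omega>)\<bar> \<le> 2 * K * sqrt (\<phi> r)"
proof -
  define h :: "int ^ 'q" where "h = (\<chi> i. - t)"
  have "\<bar>expectation (\<lambda>\<omega>. (\<xi> (a + h) \<omega> * \<xi> (b + h) \<omega>) * (\<xi> (c + h) \<omega> * \<xi> (d + h) \<omega>))
            - expectation (\<lambda>\<omega>. \<xi> (a + h) \<omega> * \<xi> (b + h) \<omega>) * expectation (\<lambda>\<omega>. \<xi> (c + h) \<omega> * \<xi> (d + h) \<omega>)\<bar>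
        \<le> 2 * K * sqrt (\<phi> r)"
  proof (rule half_space_covariance[where l=l])
    have "a + h \<in> {n. n $ l \<le> 0}" "b + h \<in> {n. n $ l \<le> 0}"
      "c + h \<in> {n. n $ l \<ge> int r}" "d + h \<in> {n. n $ l \<ge> int r}"
      using assms by (simp_all add: h_def)
    then show "(\<lambda>\<omega>. \<xi> (a + h) \<omega> * \<xi> (b + h) \<omega>) \<in> borel_measurable (field_algebra {n. n $ l \<le> 0})"
      "(\<lambda>\<omega>. \<xi> (c + h) \<omega> * \<xi> (d + h) \<omega>) \<in> borel_measurable (field_algebra {n. n $ l \<ge> int r})"
      by - (intro borel_measurable_times measurable_field_algebra; assumption)+
  qed (rule square_integrable_product)+
  then show ?thesis by (simp only: shift_two shift_four)
qed

lemma covariance_products_crude: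
  "\<bar>expectation (\<lambda>\<omega>. (\<xi> a \<omega> * \<xi> b \<omega>) * (\<xi> c \<omega> * \<xi> d \<omega>))
      - expectation (\<lambda>\<omega>. \<xi> a \<omega> * \<xi> b \<omega>) * expectation (\<lambda>\<omega>. \<xi> c \<omega> * \<xi> d \<omega>)\<bar> \<le> 2 * K"
proof -
  have sub: "subalgebra M M" by (simp add: subalgebra_def)
  have "\<bar>prob (B \<inter> A) - prob A * prob B\<bar> \<le> 1 * prob A" if "A \<in> sets M" for A B
    using abs_prob_Int_minus_product_le[OF that, of B] by simp
  from mixing_covariance[OF sub sub zero_le_one this, of "\<lambda>\<omega>. \<xi> a \<omega> * \<xi> b \<omega>" "\<lambda>\<omega>. \<xi> c \<omega> * \<xi> d \<omega>"]
  have "\<bar>expectation (\<lambda>\<omega>. (\<xi> a \<omega> * \<xi> b \<omega>) * (\<xi> c \<omega> * \<xi> d \<omega>))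
      - expectation (\<lambda>\<omega>. \<xi> a \<omega> * \<xi> b \<omega>) * expectation (\<lambda>\<omega>. \<xi> c \<omega> * \<xi> d \<omega>)\<bar>
    \<le> 2 * sqrt 1 * sqrt (expectation (\<lambda>\<omega>. (\<xi> a \<omega> * \<xi> b \<omega>)\<^sup>2)) * sqrt (expectation (\<lambda>\<omega>. (\<xi> c \<omega> * \<xi> d \<omega>)\<^sup>2))"
    using square_integrable_product(1) by simp
  also have "\<dots> \<le> 2 * sqrt 1 * sqrt K * sqrt K"
    using square_integrable_product(2) K_nonneg by (intro mult_mono real_sqrt_le_mono) auto
  also have "\<dots> = 2 * K"
    using real_sqrt_mult_self[of K] K_nonneg by simp
  finally show ?thesis .
qed

text \<open>Along a coordinate in which \<open>i' - i\<close> attains its max-norm, the pairs \<open>{i, i + j}\<close> and \<open>{i', i' + j}\<close> are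
  separated by at least \<open>max_norm (i' - i) - max_norm j\<close>.  If the pairs may overlap, the truncated
  difference is \<open>0\<close>, and the bound with \<open>\<phi> 0 = 1\<close> is Cauchy--Schwarz.\<close>

lemma covariance_lag_products:
  "\<bar>expectation (\<lambda>\<omega>. (\<xi> i \<omega> * \<xi> (i + j) \<omega>) * (\<xi> i' \<omega> * \<xi> (i' + j) \<omega>)) - (autocov j)\<^sup>2\<bar>
     \<le> 2 * K * sqrt (\<phi> (max_norm (i' - i) - max_norm j))"
proof -
  let ?r = "max_norm (i' - i) - max_norm j"
  have sep: "\<bar>expectation (\<lambda>\<omega>. (\<xi> i \<omega> * \<xi> (i + j) \<omega>) * (\<xi> i' \<omega> * \<xi> (i' + j) \<omega>)) - (autocov j)\<^sup>2\<bar>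
      \<le> 2 * K * sqrt (\<phi> r)"
    if "i' $ l - i $ l = int r + int (max_norm j)" for i i' l r
    using covariance_products_separated[of i l "max (i $ l) ((i + j) $ l)" "i + j" r i' "i' + j"]
      that max_norm_ge[of j l]
    by (simp add: expectation_lag power2_eq_square abs_le_iff max_def)
  show ?thesis
  proof (cases "?r = 0")
    case True
    then show ?thesis
      using covariance_products_crude[of i "i + j" i' "i' + j"]
      by (simp add: expectation_lag power2_eq_square phi_mix_def)
  next
    case False
    obtain l where l: "int (max_norm (i' - i)) = \<bar>(i' - i) $ l\<bar>" using max_norm_attained by blast
    show ?thesis
    proof (cases "(i' - i) $ l \<ge> 0")
      case True
      then show ?thesis using l False by (intro sep[of _ l]) auto
    next
      case neg: False
      have "\<bar>expectation (\<lambda>\<omega>. (\<xi> i' \<omega> * \<xi> (i' + j) \<omega>) * (\<xi> i \<omega> * \<xi> (i + j) \<omega>)) - (autocov j)\<^sup>2\<bar>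
          \<le> 2 * K * sqrt (\<phi> ?r)"
        using l False neg by (intro sep[of _ l]) auto
      then show ?thesis by (simp only: mult.commute[of "\<xi> i _ * _"])
    qed
  qed
qed

section \<open>Mean-square error of the sample autocovariances\<close>

lemma measurable_gamma_hat [measurable]: "gamma_hat \<xi> n j \<in> borel_measurable M"
  unfolding gamma_hat_def by measurable

text \<open>The variance is a double sum of covariances of lag products over \<open>Gamma_lag n j\<close>.  For each fixed \<open>i\<close> the
  sum over \<open>i'\<close> is a sum over the displacements \<open>i' - i\<close> and hence \<open>O((max_norm j + 1)\<^sup>q)\<close>, which leaves
  one factor \<open>1 / card (Gamma_lag n j)\<close>.\<close>

lemma gamma_hat_L2:
  assumes C: "\<And>M (F :: (int ^ 'q) set). finite F \<Longrightarrow>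
           (\<Sum>k\<in>F. sqrt (\<phi> (max_norm k - M))) \<le> C * real (M + 1) ^ CARD('q)"
    and N: "card (Gamma_lag n j) > 0"
  shows "integrable M (\<lambda>\<omega>. (gamma_hat \<xi> n j \<omega> - autocov j)\<^sup>2)"
    and "expectation (\<lambda>\<omega>. (gamma_hat \<xi> n j \<omega> - autocov j)\<^sup>2)
           \<le> 2 * K * C * real (max_norm j + 1) ^ CARD('q) / real (card (Gamma_lag n j))"
proof -
  let ?G = "Gamma_lag n j"
  let ?N = "real (card ?G)"
  define Z where "Z = (\<lambda>i \<omega>. \<xi> i \<omega> * \<xi> (i + j) \<omega> - autocov j)"
  have ZZ: "Z i \<omega> * Z i' \<omega> = (\<xi> i \<omega> * \<xi> (i + j) \<omega>) * (\<xi> i' \<omega> * \<xi> (i' + j) \<omega>)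
      - autocov j * (\<xi> i \<omega> * \<xi> (i + j) \<omega>) - autocov j * (\<xi> i' \<omega> * \<xi> (i' + j) \<omega>) + (autocov j)\<^sup>2" for i i' \<omega>
    by (simp add: Z_def algebra_simps power2_eq_square)
  have iZ: "integrable M (\<lambda>\<omega>. Z i \<omega> * Z i' \<omega>)" for i i'
    unfolding ZZ by (intro Bochner_Integration.integrable_add Bochner_Integration.integrable_diff
      integrable_four integrable_mult_right integrable_product) simp
  have "expectation (\<lambda>\<omega>. Z i \<omega> * Z i' \<omega>) =
     expectation (\<lambda>\<omega>. (\<xi> i \<omega> * \<xi> (i + j) \<omega>) * (\<xi> i' \<omega> * \<xi> (i' + j) \<omega>)) - (autocov j)\<^sup>2" for i i'
    unfolding ZZ
    by (simp add: integrable_four integrable_product expectation_lag prob_space power2_eq_square)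
  then have EZ: "expectation (\<lambda>\<omega>. Z i \<omega> * Z i' \<omega>) \<le> 2 * K * sqrt (\<phi> (max_norm (i' - i) - max_norm j))"
    for i i' using abs_le_D1[OF covariance_lag_products] by simp
  have sq: "(gamma_hat \<xi> n j \<omega> - autocov j)\<^sup>2 = (\<Sum>i\<in>?G. \<Sum>i'\<in>?G. Z i \<omega> * Z i' \<omega>) / ?N\<^sup>2" for \<omega>
  proof -
    have "gamma_hat \<xi> n j \<omega> - autocov j = (\<Sum>i\<in>?G. Z i \<omega>) / ?N"
      using N by (simp add: gamma_hat_def Z_def sum_subtractf field_simps)
    then show ?thesis by (simp add: power_divide sum_product power2_eq_square)
  qed
  show "integrable M (\<lambda>\<omega>. (gamma_hat \<xi> n j \<omega> - autocov j)\<^sup>2)"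
    unfolding sq using iZ by auto
  have "expectation (\<lambda>\<omega>. (gamma_hat \<xi> n j \<omega> - autocov j)\<^sup>2)
      = (\<Sum>i\<in>?G. \<Sum>i'\<in>?G. expectation (\<lambda>\<omega>. Z i \<omega> * Z i' \<omega>)) / ?N\<^sup>2"
    unfolding sq using iZ by (simp add: Bochner_Integration.integral_sum)
  also have "\<dots> \<le> (\<Sum>i\<in>?G. 2 * K * (C * real (max_norm j + 1) ^ CARD('q))) / ?N\<^sup>2"
  proof (intro divide_right_mono sum_mono)
    fix i
    have "(\<Sum>i'\<in>?G. expectation (\<lambda>\<omega>. Z i \<omega> * Z i' \<omega>))
        \<le> (\<Sum>i'\<in>?G. 2 * K * sqrt (\<phi> (max_norm (i' - i) - max_norm j)))"
      by (intro sum_mono EZ)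
    also have "\<dots> = 2 * K * (\<Sum>k\<in>(\<lambda>i'. i' - i) ` ?G. sqrt (\<phi> (max_norm k - max_norm j)))"
      by (subst sum.reindex) (auto simp: inj_on_def sum_distrib_left)
    also have "\<dots> \<le> 2 * K * (C * real (max_norm j + 1) ^ CARD('q))"
      using K_nonneg by (intro mult_left_mono C) (auto simp: card_Gamma_lag)
    finally show "(\<Sum>i'\<in>?G. expectation (\<lambda>\<omega>. Z i \<omega> * Z i' \<omega>))
       \<le> 2 * K * (C * real (max_norm j + 1) ^ CARD('q))" .
  qed simp
  also have "\<dots> = 2 * K * C * real (max_norm j + 1) ^ CARD('q) / ?N"
    using N by (simp add: power2_eq_square field_simps)
  finally show "expectation (\<lambda>\<omega>. (gamma_hat \<xi> n j \<omega> - autocov j)\<^sup>2)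
      \<le> 2 * K * C * real (max_norm j + 1) ^ CARD('q) / ?N" .
qed

end

section \<open>Passage to the limit\<close>

lemma eventually_multi_at_top:
  "eventually P (multi_at_top :: (nat ^ 'q::finite) filter) \<longleftrightarrow> (\<exists>N. \<forall>n. (\<forall>i. N \<le> n $ i) \<longrightarrow> P n)"
  unfolding multi_at_top_def by (simp add: eventually_filtercomap_at_top_linorder)

lemma eventually_ge_multi_at_top: "\<forall>\<^sub>F n in multi_at_top. \<forall>i. N \<le> n $ i"
  unfolding eventually_multi_at_top by blast

lemma lag_box_exhausts: "filterlim lag_box (finite_subsets_at_top UNIV) multi_at_top"
  unfolding filterlim_finite_subsets_at_top
proof (intro allI impI)
  fix X :: "(int ^ 'a) set" assume "finite X \<and> X \<subseteq> UNIV"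
  then have "finite X" by simp
  then have max: "max_norm k \<le> Max (insert 0 (max_norm ` X))" if "k \<in> X" for k
    using that by (intro Max_ge) auto
  show "\<forall>\<^sub>F m in multi_at_top. finite (lag_box m) \<and> X \<subseteq> lag_box m \<and> lag_box m \<subseteq> UNIV"
    using eventually_ge_multi_at_top[of "Max (insert 0 (max_norm ` X))"]
  proof eventually_elim
    case (elim m)
    have "k \<in> lag_box m" if "k \<in> X" for k
      unfolding lag_box_def
    proof (intro CollectI allI)
      fix i
      have "max_norm k \<le> m $ i" using max[OF that] elim le_trans by blast
      then show "\<bar>k $ i\<bar> \<le> int (m $ i)" using max_norm_ge[of k i] by linarith
    qed
    then show ?case by (auto simp: finite_lag_box)
  qed
qed

text \<open>Dominated convergence for sums over varying index sets along an arbitrary filter: up to \<open>B\<close> times an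
  arbitrarily small tail of \<open>\<Sum>\<bar>\<gamma>\<bar>\<close>, only finitely many \<open>k\<close> matter.\<close>

lemma tendsto_sum_dominated:
  fixes \<gamma> :: "'k \<Rightarrow> real" and e :: "'n \<Rightarrow> 'k \<Rightarrow> real"
  assumes sm: "(\<lambda>k. \<bar>\<gamma> k\<bar>) summable_on UNIV"
    and e0: "\<And>k. ((\<lambda>n. e n k) \<longlongrightarrow> 0) F"
    and e: "\<And>n k. 0 \<le> e n k" "\<And>n k. e n k \<le> B" and L: "\<And>n. finite (L n)"
  shows "((\<lambda>n. \<Sum>k\<in>L n. \<bar>\<gamma> k\<bar> * e n k) \<longlongrightarrow> 0) F"
proof (rule tendstoI)
  fix \<epsilon> :: real assume "\<epsilon> > 0"
  have B: "0 \<le> B" using e order.trans by blast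
  define \<delta> where "\<delta> = \<epsilon> / (2 * (B + 1))"
  have \<delta>: "\<delta> > 0" "B * \<delta> \<le> \<epsilon> / 2" using \<open>\<epsilon> > 0\<close> B by (auto simp: \<delta>_def field_simps)
  let ?T = "infsum (\<lambda>k. \<bar>\<gamma> k\<bar>) UNIV"
  have "(sum (\<lambda>k. \<bar>\<gamma> k\<bar>) \<longlongrightarrow> ?T) (finite_subsets_at_top UNIV)"
    using has_sum_infsum[OF sm] by (simp add: has_sum_def)
  then have "\<forall>\<^sub>F S in finite_subsets_at_top UNIV. dist (\<Sum>k\<in>S. \<bar>\<gamma> k\<bar>) ?T < \<delta>"
    using \<delta>(1) tendstoD by blast
  then obtain S where S: "finite S" "\<bar>(\<Sum>k\<in>S. \<bar>\<gamma> k\<bar>) - ?T\<bar> < \<delta>"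
    unfolding eventually_finite_subsets_at_top dist_real_def by blast
  have tail: "(\<Sum>k\<in>A - S. \<bar>\<gamma> k\<bar>) \<le> \<delta>" if "finite A" for A
  proof -
    have "(\<Sum>k\<in>A - S. \<bar>\<gamma> k\<bar>) + (\<Sum>k\<in>S. \<bar>\<gamma> k\<bar>) = (\<Sum>k\<in>A \<union> S. \<bar>\<gamma> k\<bar>)"
      using that S by (subst sum.union_disjoint[symmetric]) (auto intro: sum.cong)
    also have "\<dots> \<le> ?T" using that S sm by (intro finite_sum_le_infsum) auto
    finally show ?thesis using S(2) by linarith
  qed
  have "((\<lambda>n. \<Sum>k\<in>S. \<bar>\<gamma> k\<bar> * e n k) \<longlongrightarrow> 0) F"
    by (intro tendsto_null_sum tendsto_mult_right_zero e0)
  then have "\<forall>\<^sub>F n in F. (\<Sum>k\<in>S. \<bar>\<gamma> k\<bar> * e n k) < \<epsilon> / 2"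
    using \<open>\<epsilon> > 0\<close> by (intro order_tendstoD(2)[where y=0]) auto
  then show "\<forall>\<^sub>F n in F. dist (\<Sum>k\<in>L n. \<bar>\<gamma> k\<bar> * e n k) 0 < \<epsilon>"
  proof eventually_elim
    case (elim n)
    have "(\<Sum>k\<in>L n. \<bar>\<gamma> k\<bar> * e n k) \<le> (\<Sum>k\<in>S \<union> (L n - S). \<bar>\<gamma> k\<bar> * e n k)"
      using S L e by (intro sum_mono2) auto
    also have "\<dots> = (\<Sum>k\<in>S. \<bar>\<gamma> k\<bar> * e n k) + (\<Sum>k\<in>L n - S. \<bar>\<gamma> k\<bar> * e n k)"
      using S L by (intro sum.union_disjoint) auto
    also have "(\<Sum>k\<in>L n - S. \<bar>\<gamma> k\<bar> * e n k) \<le> (\<Sum>k\<in>L n - S. \<bar>\<gamma> k\<bar> * B)"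
      using e by (intro sum_mono mult_left_mono) auto
    also have "\<dots> = B * (\<Sum>k\<in>L n - S. \<bar>\<gamma> k\<bar>)" by (simp add: sum_distrib_left mult.commute)
    also have "\<dots> \<le> B * \<delta>" using tail[OF L] B by (intro mult_left_mono) auto
    finally show ?case using elim \<delta>(2) e by (simp add: sum_nonneg)
  qed
qed

lemma (in prob_space) tendsto_in_prob_if_L1:
  assumes int: "\<And>n. integrable M (X n)"
    and le: "\<And>n. expectation (\<lambda>\<omega>. \<bar>X n \<omega> - l\<bar>) \<le> R n" and R: "(R \<longlongrightarrow> 0) F"
  shows "tendsto_in_prob M X l F"
  unfolding tendsto_in_prob_def
proof (intro allI impI)
  fix \<epsilon> :: real assume \<epsilon>: "\<epsilon> > 0"
  have le': "prob {\<omega> \<in> space M. \<bar>X n \<omega> - l\<bar> > \<epsilon>} \<le> R n / \<epsilon>" for n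
  proof -
    have [measurable]: "X n \<in> borel_measurable M" using int by auto
    have "prob {\<omega> \<in> space M. \<bar>X n \<omega> - l\<bar> > \<epsilon>} \<le> prob {\<omega> \<in> space M. \<bar>X n \<omega> - l\<bar> \<ge> \<epsilon>}"
      by (intro finite_measure_mono) auto
    also have "\<dots> \<le> expectation (\<lambda>\<omega>. \<bar>X n \<omega> - l\<bar>) / \<epsilon>"
      using int \<epsilon> by (intro integral_Markov_inequality_measure[where A="space M"]) auto
    also have "\<dots> \<le> R n / \<epsilon>" using le \<epsilon> by (intro divide_right_mono) auto
    finally show ?thesis .
  qed
  have lim: "((\<lambda>n. R n / \<epsilon>) \<longlongrightarrow> 0) F" using tendsto_divide[OF R tendsto_const, of \<epsilon>] \<epsilon> by simp
  show "((\<lambda>n. prob {\<omega> \<in> space M. \<bar>X n \<omega> - l\<bar> > \<epsilon>}) \<longlongrightarrow> 0) F"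
    by (rule tendsto_sandwich[OF _ _ tendsto_const lim]) (simp_all add: le')
qed

context stationary_field
begin

lemma integrable_gamma_hat: "integrable M (gamma_hat \<xi> n j)"
  unfolding gamma_hat_def by (intro integrable_divide_zero Bochner_Integration.integrable_sum integrable_product)

lemma mixing_sum_bound:
  assumes "summable (\<lambda>r. real (Suc r) ^ (CARD('q) - 1) * sqrt (\<phi> (Suc r)))"
  shows "\<exists>C>0. \<forall>M (F :: (int ^ 'q) set). finite F \<longrightarrow>
           (\<Sum>k\<in>F. sqrt (\<phi> (max_norm k - M))) \<le> C * real (M + 1) ^ CARD('q)"
proof (rule sum_max_norm_shifted_le[of "\<lambda>r. sqrt (\<phi> r)", where 'q='q])
  fix C assume "C > 0" "\<And>M (F :: (int ^ 'q) set). finite F \<Longrightarrow>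
           (\<Sum>k\<in>F. sqrt (\<phi> (max_norm k - M))) \<le> C * real (M + 1) ^ CARD('q)"
  then show ?thesis by (intro exI[of _ C]) simp
qed (use assms phi_mix_nonneg in \<open>simp_all add: phi_mix_def[of _ _ 0]\<close>)

lemma autocov_abs_summable:
  assumes sm: "summable (\<lambda>r. real (Suc r) ^ (CARD('q) - 1) * sqrt (\<phi> (Suc r)))"
    and centred: "expectation (\<xi> 0) = 0"
  shows "(\<lambda>k. \<bar>autocov k\<bar>) summable_on UNIV"
proof -
  obtain C where "C > 0" and C: "\<And>M (F :: (int ^ 'q) set). finite F \<Longrightarrow>
           (\<Sum>k\<in>F. sqrt (\<phi> (max_norm k - M))) \<le> C * real (M + 1) ^ CARD('q)"
    using mixing_sum_bound[OF sm] by meson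
  have var: "0 \<le> autocov 0"
    unfolding autocov_def by (intro Bochner_Integration.integral_nonneg) simp
  show ?thesis
  proof (rule nonneg_bdd_above_summable_on)
    show "bdd_above (sum (\<lambda>k. \<bar>autocov k\<bar>) ` {F. F \<subseteq> UNIV \<and> finite F})"
    proof (rule bdd_aboveI2)
      fix F :: "(int ^ 'q) set" assume "F \<in> {F. F \<subseteq> UNIV \<and> finite F}"
      then have F: "finite F" by simp
      have "(\<Sum>k\<in>F. \<bar>autocov k\<bar>) \<le> 2 * autocov 0 * (\<Sum>k\<in>F. sqrt (\<phi> (max_norm k)))"
        unfolding sum_distrib_left by (intro sum_mono autocov_bound centred)
      also have "\<dots> \<le> 2 * autocov 0 * C"
        using C[OF F, of 0] var by (intro mult_left_mono) auto
      finally show "(\<Sum>k\<in>F. \<bar>autocov k\<bar>) \<le> 2 * autocov 0 * C" .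
    qed
  qed simp
qed

text \<open>Let \<open>a = max m\<^sub>n\<close> and \<open>b = min n\<close>.  Eventually \<open>2a \<le> b\<close>, so that every \<open>Gamma_lag n j\<close> with \<open>j\<close> in the lag
  box has at least \<open>(b/2)\<^sup>q\<close> points, and each summand is \<open>O((a/b)\<^bsup>q/2\<^esup>)\<close>.  There are \<open>O(a\<^sup>q)\<close> summands,
  and \<open>a\<^sup>q (a/b)\<^bsup>q/2\<^esup> = (a\<^sup>3/b)\<^bsup>q/2\<^esup>\<close>: this is the origin of the cubic rate condition.\<close>

lemma sum_gamma_hat_L1_tendsto_0:
  fixes m :: "nat ^ 'q \<Rightarrow> nat ^ 'q"
  assumes sm: "summable (\<lambda>r. real (Suc r) ^ (CARD('q) - 1) * sqrt (\<phi> (Suc r)))"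
    and m: "filterlim m multi_at_top multi_at_top"
    and rate: "((\<lambda>n. real (MAX i. m n $ i) ^ 3 / real (MIN i. n $ i)) \<longlongrightarrow> 0) multi_at_top"
  shows "((\<lambda>n. \<Sum>j\<in>lag_box (m n). expectation (\<lambda>\<omega>. \<bar>gamma_hat \<xi> n j \<omega> - autocov j\<bar>)) \<longlongrightarrow> 0) multi_at_top"
proof -
  let ?q = "CARD('q)"
  define a where "a = (\<lambda>n. MAX i. m n $ i)"
  define b where "b = (\<lambda>n :: nat ^ 'q. MIN i. n $ i)"
  obtain C where C0: "C > 0" and C: "\<And>M (F :: (int ^ 'q) set). finite F \<Longrightarrow>
           (\<Sum>k\<in>F. sqrt (\<phi> (max_norm k - M))) \<le> C * real (M + 1) ^ CARD('q)"
    using mixing_sum_bound[OF sm] by meson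
  define D where "D = 3 ^ ?q * sqrt (2 * K * C * 4 ^ ?q)"
  have ev_m: "\<forall>\<^sub>F n in multi_at_top. \<forall>i. 1 \<le> m n $ i"
    using filterlim_iff[THEN iffD1, OF m, rule_format, OF eventually_ge_multi_at_top] .
  have ev_r: "\<forall>\<^sub>F n in multi_at_top. real (a n) ^ 3 / real (b n) < 1 / 2"
    using order_tendstoD(2)[OF rate, of "1 / 2"] by (simp add: a_def b_def)
  have bound: "\<forall>\<^sub>F n in multi_at_top.
      (\<Sum>j\<in>lag_box (m n). expectation (\<lambda>\<omega>. \<bar>gamma_hat \<xi> n j \<omega> - autocov j\<bar>))
        \<le> D * sqrt ((real (a n) ^ 3 / real (b n)) ^ ?q)"
    using ev_m ev_r eventually_ge_multi_at_top[of 1]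
  proof eventually_elim
    case (elim n)
    have a1: "1 \<le> a n" using elim(1) unfolding a_def by (subst Max_ge_iff) auto
    have b1: "1 \<le> b n" using elim(3) unfolding b_def by simp
    have bn: "b n \<le> n $ l" for l unfolding b_def by simp
    \<comment> \<open>\<open>a \<le> a\<^sup>3 \<le> b/2\<close> uses that the truncation points are eventually positive\<close>
    have "real (a n) \<le> real (a n) ^ 3" using a1 by (intro self_le_power) auto
    also have "real (a n) ^ 3 \<le> real (b n) / 2" using elim(2) b1 by (simp add: field_simps)
    finally have ab: "2 * a n \<le> b n" by linarith
    have L1: "expectation (\<lambda>\<omega>. \<bar>gamma_hat \<xi> n j \<omega> - autocov j\<bar>)
        \<le> sqrt (2 * K * C * 4 ^ ?q * (real (a n) / real (b n)) ^ ?q)"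
      if j: "j \<in> lag_box (m n)" for j
    proof -
      have ja: "max_norm j \<le> a n" using max_norm_lag_box[OF j] by (simp add: a_def)
      have "(real (b n) / 2) ^ ?q \<le> (\<Prod>l\<in>(UNIV :: 'q set). real (nat (int (n $ l) - \<bar>j $ l\<bar>)))"
        unfolding prod_constant[symmetric]
      proof (intro prod_mono conjI)
        fix l
        show "real (b n) / 2 \<le> real (nat (int (n $ l) - \<bar>j $ l\<bar>))"
          using bn[of l] max_norm_ge[of j l] ja ab by linarith
      qed simp
      also have "\<dots> = real (card (Gamma_lag n j))" by (simp add: card_Gamma_lag)
      finally have N: "(real (b n) / 2) ^ ?q \<le> real (card (Gamma_lag n j))" .
      have pos: "0 < (real (b n) / 2) ^ ?q" using b1 by simp
      have "0 < card (Gamma_lag n j)" using N pos by linarith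
      note L2 = gamma_hat_L2[OF C this]
      have "expectation (\<lambda>\<omega>. \<bar>gamma_hat \<xi> n j \<omega> - autocov j\<bar>)
          \<le> sqrt (expectation (\<lambda>\<omega>. (gamma_hat \<xi> n j \<omega> - autocov j)\<^sup>2))"
        using L2(1) by (intro expectation_abs_le_sqrt) auto
      also have "expectation (\<lambda>\<omega>. (gamma_hat \<xi> n j \<omega> - autocov j)\<^sup>2)
          \<le> 2 * K * C * real (max_norm j + 1) ^ ?q / real (card (Gamma_lag n j))"
        by (rule L2(2))
      also have "\<dots> \<le> 2 * K * C * (2 * real (a n)) ^ ?q / (real (b n) / 2) ^ ?q"
        using N pos K_nonneg C0 ja a1 by (intro frac_le mult_left_mono power_mono) auto
      also have "\<dots> = 2 * K * C * 4 ^ ?q * (real (a n) / real (b n)) ^ ?q"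
      proof -
        have "(2 * real (a n)) ^ ?q / (real (b n) / 2) ^ ?q = 4 ^ ?q * (real (a n) / real (b n)) ^ ?q"
          by (simp only: power_divide[symmetric] power_mult_distrib[symmetric]) simp
        then show ?thesis by (simp only: times_divide_eq_right[symmetric] mult.assoc)
      qed
      finally show ?thesis by simp
    qed
    have "real (card (lag_box (m n))) \<le> real ((2 * a n + 1) ^ ?q)"
      unfolding of_nat_le_iff a_def by (rule card_lag_box_le)
    also have "\<dots> \<le> real ((3 * a n) ^ ?q)"
      unfolding of_nat_le_iff using a1 by (intro power_mono) auto
    finally have crd: "real (card (lag_box (m n))) \<le> 3 ^ ?q * real (a n) ^ ?q"
      by (simp add: power_mult_distrib)
    have "(\<Sum>j\<in>lag_box (m n). expectation (\<lambda>\<omega>. \<bar>gamma_hat \<xi> n j \<omega> - autocov j\<bar>))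
        \<le> real (card (lag_box (m n))) * sqrt (2 * K * C * 4 ^ ?q * (real (a n) / real (b n)) ^ ?q)"
      using L1 by (intro sum_bounded_above)
    also have "\<dots> \<le> (3 ^ ?q * real (a n) ^ ?q) * sqrt (2 * K * C * 4 ^ ?q * (real (a n) / real (b n)) ^ ?q)"
      using crd K_nonneg C0 by (intro mult_right_mono) auto
    also have "\<dots> = D * (real (a n) ^ ?q * sqrt ((real (a n) / real (b n)) ^ ?q))"
      by (simp only: D_def real_sqrt_mult mult_ac)
    also have "real (a n) ^ ?q * sqrt ((real (a n) / real (b n)) ^ ?q)
        = sqrt ((real (a n) ^ ?q)\<^sup>2 * (real (a n) / real (b n)) ^ ?q)"
      by (simp add: real_sqrt_mult)
    also have "(real (a n) ^ ?q)\<^sup>2 * (real (a n) / real (b n)) ^ ?q = (real (a n) ^ 3 / real (b n)) ^ ?q"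
      by (simp add: power2_eq_square power3_eq_cube flip: power_mult_distrib)
    finally show ?case .
  qed
  have "((\<lambda>n. D * sqrt ((real (a n) ^ 3 / real (b n)) ^ ?q)) \<longlongrightarrow> D * sqrt (0 ^ ?q)) multi_at_top"
    using rate unfolding a_def b_def by (intro tendsto_intros)
  then have lim: "((\<lambda>n. D * sqrt ((real (a n) ^ 3 / real (b n)) ^ ?q)) \<longlongrightarrow> 0) multi_at_top"
    by (simp add: zero_power)
  show ?thesis
    by (rule tendsto_sandwich[OF _ bound tendsto_const lim])
      (auto intro!: always_eventually sum_nonneg Bochner_Integration.integral_nonneg)
qed

text \<open>The three terms are the estimation error of the autocovariances, the bias caused by the weights and by the
  threshold factor \<open>G\<close>, and the truncation error.  The threshold factor multiplies a deterministic
  \<open>autocov j\<close> in the second term, so that only its expectation enters; its dependence on the data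
  is harmless.\<close>

lemma threshold_estimator_L1_bound:
  fixes w :: "int ^ 'q \<Rightarrow> real"
  assumes w: "\<And>j. \<bar>w j\<bar> \<le> C"
    and G [measurable]: "\<And>j. G j \<in> borel_measurable M"
    and G01: "\<And>j \<omega>. 0 \<le> G j \<omega> \<and> G j \<omega> \<le> 1"
    and L: "finite L"
  shows "integrable M (\<lambda>\<omega>. \<Sum>j\<in>L. w j * gamma_hat \<xi> n j \<omega> * G j \<omega>)"
    and "expectation (\<lambda>\<omega>. \<bar>(\<Sum>j\<in>L. w j * gamma_hat \<xi> n j \<omega> * G j \<omega>) - s\<bar>)
      \<le> C * (\<Sum>j\<in>L. expectation (\<lambda>\<omega>. \<bar>gamma_hat \<xi> n j \<omega> - autocov j\<bar>))
        + (\<Sum>j\<in>L. \<bar>autocov j\<bar> * (C * (1 - expectation (G j)) + \<bar>w j - 1\<bar>))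
        + \<bar>(\<Sum>j\<in>L. autocov j) - s\<bar>" (is "_ \<le> ?R")
proof -
  have iG: "integrable M (G j)" for j
    by (rule integrable_const_bound[where B=1]) (use G01 in auto)
  have igG: "integrable M (\<lambda>\<omega>. gamma_hat \<xi> n j \<omega> * G j \<omega>)" for j
  proof (rule Bochner_Integration.integrable_bound[OF integrable_gamma_hat[of n j]])
    show "AE \<omega> in M. norm (gamma_hat \<xi> n j \<omega> * G j \<omega>) \<le> norm (gamma_hat \<xi> n j \<omega>)"
      using G01 by (auto simp: abs_mult intro!: mult_left_le)
  qed measurable
  show int: "integrable M (\<lambda>\<omega>. \<Sum>j\<in>L. w j * gamma_hat \<xi> n j \<omega> * G j \<omega>)"
    unfolding mult.assoc by (intro Bochner_Integration.integrable_sum integrable_mult_right igG)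
  let ?g = "\<lambda>j \<omega>. \<bar>gamma_hat \<xi> n j \<omega> - autocov j\<bar>"
  let ?B = "\<lambda>\<omega>. C * (\<Sum>j\<in>L. ?g j \<omega>)
      + (\<Sum>j\<in>L. \<bar>autocov j\<bar> * (C * (1 - G j \<omega>) + \<bar>w j - 1\<bar>)) + \<bar>(\<Sum>j\<in>L. autocov j) - s\<bar>"
  have ig: "integrable M (?g j)" for j using integrable_gamma_hat[of n j] by simp
  have le: "\<bar>(\<Sum>j\<in>L. w j * gamma_hat \<xi> n j \<omega> * G j \<omega>) - s\<bar> \<le> ?B \<omega>" for \<omega>
  proof -
    have 1: "\<bar>w j * gamma_hat \<xi> n j \<omega> * G j \<omega> - autocov j\<bar>
        \<le> C * ?g j \<omega> + \<bar>autocov j\<bar> * (C * (1 - G j \<omega>) + \<bar>w j - 1\<bar>)" for j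
    proof -
      have "w j * gamma_hat \<xi> n j \<omega> * G j \<omega> - autocov j =
          w j * G j \<omega> * (gamma_hat \<xi> n j \<omega> - autocov j)
          + autocov j * (w j * (G j \<omega> - 1) + (w j - 1))"
        by (simp add: algebra_simps)
      moreover have "\<bar>w j * G j \<omega> * (gamma_hat \<xi> n j \<omega> - autocov j)\<bar> \<le> C * ?g j \<omega>"
        using w[of j] G01[of j \<omega>] mult_mono[OF w[of j], of "G j \<omega>" 1]
        by (auto simp: abs_mult intro!: mult_right_mono)
      moreover have "\<bar>autocov j * (w j * (G j \<omega> - 1) + (w j - 1))\<bar>
          \<le> \<bar>autocov j\<bar> * (C * (1 - G j \<omega>) + \<bar>w j - 1\<bar>)"
      proof -
        have "\<bar>w j * (G j \<omega> - 1)\<bar> \<le> C * (1 - G j \<omega>)"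
          using w[of j] G01[of j \<omega>] by (auto simp: abs_mult intro!: mult_right_mono)
        then have "\<bar>w j * (G j \<omega> - 1) + (w j - 1)\<bar> \<le> C * (1 - G j \<omega>) + \<bar>w j - 1\<bar>"
          by linarith
        then show ?thesis unfolding abs_mult by (intro mult_left_mono) auto
      qed
      ultimately show ?thesis by linarith
    qed
    have "(\<Sum>j\<in>L. w j * gamma_hat \<xi> n j \<omega> * G j \<omega>) - s =
        (\<Sum>j\<in>L. w j * gamma_hat \<xi> n j \<omega> * G j \<omega> - autocov j) + ((\<Sum>j\<in>L. autocov j) - s)"
      by (simp add: sum_subtractf)
    moreover have "\<bar>\<Sum>j\<in>L. w j * gamma_hat \<xi> n j \<omega> * G j \<omega> - autocov j\<bar>
        \<le> C * (\<Sum>j\<in>L. ?g j \<omega>) + (\<Sum>j\<in>L. \<bar>autocov j\<bar> * (C * (1 - G j \<omega>) + \<bar>w j - 1\<bar>))"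
      unfolding sum_distrib_left sum.distrib[symmetric]
      using 1 by (intro order.trans[OF sum_abs] sum_mono)
    ultimately show ?thesis by linarith
  qed
  have iB: "integrable M ?B" using ig iG by auto
  have "expectation (\<lambda>\<omega>. \<bar>(\<Sum>j\<in>L. w j * gamma_hat \<xi> n j \<omega> * G j \<omega>) - s\<bar>) \<le> expectation ?B"
    using int iB le by (intro integral_mono) auto
  also have "\<dots> = ?R"
    using ig iG by (simp add: Bochner_Integration.integral_sum prob_space)
  finally show "expectation (\<lambda>\<omega>. \<bar>(\<Sum>j\<in>L. w j * gamma_hat \<xi> n j \<omega> * G j \<omega>) - s\<bar>) \<le> ?R" .
qed

end

theorem theorem3p1:
  fixes M :: "'a measure"
    and \<xi> :: "int ^ 'q::finite \<Rightarrow> 'a \<Rightarrow> real"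
    and w :: "nat ^ 'q \<Rightarrow> int ^ 'q \<Rightarrow> real"
    and C\<^sub>w :: real
    and m :: "nat ^ 'q \<Rightarrow> nat ^ 'q"
    and g :: "real \<times> real \<Rightarrow> real"
    and c :: "nat ^ 'q \<Rightarrow> int ^ 'q \<Rightarrow> real"
  assumes "random_field M \<xi>"
    and "strictly_stationary M \<xi>"
    and "phi_mixing M \<xi>"
    and "integral\<^sup>L M (\<xi> 0) = 0"
    and "integrable M (\<lambda>\<omega>. \<xi> 0 \<omega> ^ 4)"
    and "summable (\<lambda>r. real (Suc r) ^ (CARD('q) - 1) * sqrt (phi_mix M \<xi> (Suc r)))"
    and "\<And>j. ((\<lambda>k. w k j) \<longlongrightarrow> 1) multi_at_top"
    and "\<And>k j. \<bar>w k j\<bar> \<le> C\<^sub>w"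
    and "filterlim m multi_at_top multi_at_top"
    and "(\<lambda>n. real (MAX i. m n $ i) ^ 3 / real (MIN i. n $ i)) \<in> o[multi_at_top](\<lambda>_. 1)"
    and "g \<in> UNIV \<times> {0..} \<rightarrow> {0..1}"
    and "g \<in> borel_measurable (restrict_space borel (UNIV \<times> {0..}))"
    and "\<And>n j. c n j \<ge> 0"
    and "\<And>j. ((\<lambda>n. integral\<^sup>L M (\<lambda>\<omega>. g (gamma_hat \<xi> n j \<omega>, c n j))) \<longlongrightarrow> 1) multi_at_top"
  shows "tendsto_in_prob M (sigma_hat_th \<xi> w g c m) (asymptotic_variance M \<xi>) multi_at_top"
proof -
  interpret prob_space M using assms(1) by (simp add: random_field_def)
  interpret stationary_field M \<xi>
    by unfold_locales (use assms(1,2,5) in \<open>auto simp: random_field_def\<close>)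
  define G where "G = (\<lambda>n j \<omega>. g (gamma_hat \<xi> n j \<omega>, c n j))"
  define s where "s = asymptotic_variance M \<xi>"
  have G01: "0 \<le> G n j \<omega> \<and> G n j \<omega> \<le> 1" for n j \<omega>
  proof -
    have "(gamma_hat \<xi> n j \<omega>, c n j) \<in> UNIV \<times> {0..}" using assms(13) by simp
    then have "G n j \<omega> \<in> {0..1}" unfolding G_def by (rule funcset_mem[OF assms(11)])
    then show ?thesis by simp
  qed
  have G: "G n j \<in> borel_measurable M" for n j
  proof -
    have "(\<lambda>\<omega>. (gamma_hat \<xi> n j \<omega>, c n j)) \<in> measurable M (restrict_space borel (UNIV \<times> {0..}))"
      using assms(13) by (intro measurable_restrict_space2 borel_measurable_Pair) auto
    from measurable_compose[OF this assms(12)] show ?thesis by (simp add: G_def)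
  qed
  have C0: "0 \<le> C\<^sub>w" using assms(8)[of undefined undefined] by linarith
  define e where "e = (\<lambda>n j. C\<^sub>w * (1 - expectation (G n j)) + \<bar>w (m n) j - 1\<bar>)"
  define R where "R = (\<lambda>n.
      C\<^sub>w * (\<Sum>j\<in>lag_box (m n). expectation (\<lambda>\<omega>. \<bar>gamma_hat \<xi> n j \<omega> - autocov j\<bar>))
      + (\<Sum>j\<in>lag_box (m n). \<bar>autocov j\<bar> * e n j) + \<bar>(\<Sum>j\<in>lag_box (m n). autocov j) - s\<bar>)"
  have sigma: "sigma_hat_th \<xi> w g c m n = (\<lambda>\<omega>. \<Sum>j\<in>lag_box (m n). w (m n) j * gamma_hat \<xi> n j \<omega> * G n j \<omega>)"
    for n by (simp add: sigma_hat_th_def G_def fun_eq_iff)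
  have bound: "integrable M (\<lambda>\<omega>. \<Sum>j\<in>lag_box (m n). w (m n) j * gamma_hat \<xi> n j \<omega> * G n j \<omega>)"
    "expectation (\<lambda>\<omega>. \<bar>(\<Sum>j\<in>lag_box (m n). w (m n) j * gamma_hat \<xi> n j \<omega> * G n j \<omega>) - s\<bar>) \<le> R n"
    for n
    unfolding R_def e_def
    by (rule threshold_estimator_L1_bound[OF assms(8) G G01 finite_lag_box])+
  have sm: "(\<lambda>k. \<bar>autocov k\<bar>) summable_on UNIV"
    by (rule autocov_abs_summable[OF assms(6,4)])
  have lim1: "((\<lambda>n. \<Sum>j\<in>lag_box (m n). expectation (\<lambda>\<omega>. \<bar>gamma_hat \<xi> n j \<omega> - autocov j\<bar>)) \<longlongrightarrow> 0) multi_at_top"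
    by (rule sum_gamma_hat_L1_tendsto_0[OF assms(6,9)]) (use smalloD_tendsto[OF assms(10)] in simp)
  have EG: "0 \<le> expectation (G n j) \<and> expectation (G n j) \<le> 1" for n j
    using G01 by (auto intro!: Bochner_Integration.integral_nonneg integral_le_const
      integrable_const_bound[where B=1] G)
  have lim2: "((\<lambda>n. \<Sum>j\<in>lag_box (m n). \<bar>autocov j\<bar> * e n j) \<longlongrightarrow> 0) multi_at_top"
  proof (rule tendsto_sum_dominated[OF sm _ _ _ finite_lag_box])
    fix j
    have "((\<lambda>n. w (m n) j) \<longlongrightarrow> 1) multi_at_top"
      by (rule filterlim_compose[OF assms(7,9)])
    then have "((\<lambda>n. e n j) \<longlongrightarrow> C\<^sub>w * (1 - 1) + \<bar>1 - 1\<bar>) multi_at_top"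
      unfolding e_def G_def by (intro tendsto_intros assms(14))
    then show "((\<lambda>n. e n j) \<longlongrightarrow> 0) multi_at_top" by simp
  next
    fix n j
    show "0 \<le> e n j" using C0 EG by (simp add: e_def)
    have "C\<^sub>w * (1 - expectation (G n j)) \<le> C\<^sub>w * 1" using EG C0 by (intro mult_left_mono) auto
    moreover have "\<bar>w (m n) j - 1\<bar> \<le> C\<^sub>w + 1" using assms(8)[of "m n" j] by linarith
    ultimately show "e n j \<le> 2 * C\<^sub>w + 1" by (simp add: e_def)
  qed
  have lim3: "((\<lambda>n. \<Sum>j\<in>lag_box (m n). autocov j) \<longlongrightarrow> s) multi_at_top"
  proof -
    have "autocov summable_on UNIV"
      by (rule abs_summable_summable) (use sm in simp)
    then have "(autocov has_sum infsum autocov UNIV) UNIV" by (rule has_sum_infsum)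
    moreover have "infsum autocov UNIV = s"
      by (simp add: s_def asymptotic_variance_def autocov_def[abs_def])
    ultimately have "(sum autocov \<longlongrightarrow> s) (finite_subsets_at_top UNIV)"
      by (simp only: has_sum_def)
    from filterlim_compose[OF filterlim_compose[OF this lag_box_exhausts] assms(9)]
    show ?thesis by simp
  qed
  have "(R \<longlongrightarrow> C\<^sub>w * 0 + 0 + \<bar>s - s\<bar>) multi_at_top"
    unfolding R_def by (intro tendsto_intros lim1 lim2 lim3)
  then have R: "(R \<longlongrightarrow> 0) multi_at_top" by simp
  show ?thesis
    unfolding s_def[symmetric]
    by (rule tendsto_in_prob_if_L1[OF _ _ R]) (simp_all only: sigma bound)
qed

end
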